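(* Let $p$ be an odd prime, $m\ge 1$, $q=p^m$, let $g$ be a generator of $\mathbb{F}_q^*$, and let $y\in\mathbb{F}_q^*$ be non-quartic (i.e. $y\neq z^4$ for all $z\in\mathbb{F}_q$). For $n\ge 2$ let $M_n(y)=\#\{(x_1,\dots,x_n)\in\mathbb{F}_q^n: x_1^4+\cdots+x_{n-1}^4+yx_n^4=0\}$. (i) Suppose $q\equiv 1\pmod 4$. Define integers $s,t$ as follows: if $p\equiv 1\pmod 4$, then $s,t$ are the unique integers with $q=s^2+4t^2$, $\gcd(p,s)=1$, $s\equiv 1\pmod 4$ and $2t\equiv s\,g^{3(q-1)/4}\pmod p$ (equality in $\mathbb{F}_q$); if $p\equiv 3\pmod 4$, then $s=(-p)^{m/2}$, $t=0$. For $c\in\mathbb{F}_q^*$ define $$B_1(c,x)=\begin{cases}3x-(6s+3)x^2+(-q+4s^2)x^3, & \operatorname{ind}_g(c)\equiv 0\pmod 4,\\ -x+(2s+8t-3)x^2+(-q-8st)x^3, & \operatorname{ind}_g(c)\equiv 1\pmod 4,\\ -x+(2s-3)x^2+(-q+16t^2)x^3, & \operatorname{ind}_g(c)\equiv 2\pmod 4,\\ -x+(2s-8t-3)x^2+(-q+8st)x^3, & \operatorname{ind}_g(c)\equiv 3\pmod 4,\end{cases}$$ $$B_2(c,x)=\begin{cases}3x+(2s+1)x^2+(3q-4s^2)x^3, & \operatorname{ind}_g(c)\equiv 0\pmod 4,\\ -x+(2s-8t+1)x^2+(3q+8st)x^3, & \operatorname{ind}_g(c)\equiv 1\pmod 4,\\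 -x+(-6s+1)x^2+(-5q-16t^2)x^3, & \operatorname{ind}_g(c)\equiv 2\pmod 4,\\ -x+(2s+8t+1)x^2+(3q-8st)x^3, & \operatorname{ind}_g(c)\equiv 3\pmod 4.\end{cases}$$ Then $$\sum_{n=1}^{\infty}M_{n+1}(y)x^n=\begin{cases}\dfrac{qx}{1-qx}+\dfrac{(q-1)\big(3x^2+B_1(y,x)\big)}{1-6qx^2+8qsx^3+(q^2-4qs^2)x^4}, & q\equiv 1\pmod 8,\\[2ex] \dfrac{qx}{1-qx}+\dfrac{(q-1)\big(-x^2+B_2(-y,x)\big)}{1+2qx^2+8qsx^3+(9q^2-4qs^2)x^4}, & q\equiv 5\pmod 8.\end{cases}$$ (ii) Suppose $q\equiv 3\pmod 4$. Then $$\sum_{n=1}^{\infty}M_{n+1}(y)x^n=\frac{qx}{1-qx}+\frac{(q-1)x}{1+qx^2}.$$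
   Context: For $c\in\mathbb{F}_q^*$, $\operatorname{ind}_g(c)$ denotes the integer $i\in\{0,\dots,q-2\}$ with $g^i=c$. Integers are mapped into $\mathbb{F}_q$ via the prime subfield. *)

theory Defs
  imports
    "HOL-Number_Theory.Cong"
    "HOL-Computational_Algebra.Formal_Power_Series"
    "HOL-Computational_Algebra.Primes"
    "HOL-Library.FuncSet"
    "HOL-Library.Cardinality"
begin

definition generates_units :: "'a::{field,finite} \<Rightarrow> bool" where
  "generates_units g \<longleftrightarrow> range (\<lambda>i::int. g powi i) = UNIV - {0}"

definition ind :: "'a::{field,finite} \<Rightarrow> 'a \<Rightarrow> nat" where
  "ind g c = (THE i. i \<in> {0..CARD('a) - 2} \<and> g ^ i = c)"

definition M :: "nat \<Rightarrow> 'a::{field,finite} \<Rightarrow> nat" where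
  "M n y = card {x \<in> {1..n} \<rightarrow>\<^sub>E (UNIV :: 'a set).
     (\<Sum>i = 1..n - 1. x i ^ 4) + y * x n ^ 4 = 0}"

definition M_gf :: "'a::{field,finite} \<Rightarrow> rat fps" where
  "M_gf y = Abs_fps (\<lambda>n. if n \<ge> 1 then of_nat (M (n + 1) y) else 0)"

text \<open>The field here has \<open>p ^ m\<close> elements with \<open>p ^ m\<close> congruent to 1 modulo 4, so
  in the second case \<open>m\<close> is even.\<close>

definition quartic_pair :: "nat \<Rightarrow> nat \<Rightarrow> 'a::{field,finite} \<Rightarrow> int \<Rightarrow> int \<Rightarrow> bool" where
  "quartic_pair p m g s t \<longleftrightarrow>
     (if [p = 1] (mod 4) then
        int (p ^ m) = s ^ 2 + 4 * t ^ 2 \<and> gcd (int p) s = 1 \<and> [s = 1] (mod 4) \<and>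
        (of_int (2 * t) :: 'a) = of_int s * g ^ (3 * (p ^ m - 1) div 4)
      else s = (- int p) ^ (m div 2) \<and> t = 0)"

definition B1 :: "int \<Rightarrow> int \<Rightarrow> 'a::{field,finite} \<Rightarrow> 'a \<Rightarrow> rat fps" where
  "B1 s t g c = (let q = int CARD('a); X = fps_X in
     if [ind g c = 0] (mod 4) then
       3 * X - of_int (6 * s + 3) * X ^ 2 + of_int (- q + 4 * s ^ 2) * X ^ 3
     else if [ind g c = 1] (mod 4) then
       - X + of_int (2 * s + 8 * t - 3) * X ^ 2 + of_int (- q - 8 * s * t) * X ^ 3
     else if [ind g c = 2] (mod 4) then
       - X + of_int (2 * s - 3) * X ^ 2 + of_int (- q + 16 * t ^ 2) * X ^ 3
     else
       - X + of_int (2 * s - 8 * t - 3) * X ^ 2 + of_int (- q + 8 * s * t) * X ^ 3)"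

definition B2 :: "int \<Rightarrow> int \<Rightarrow> 'a::{field,finite} \<Rightarrow> 'a \<Rightarrow> rat fps" where
  "B2 s t g c = (let q = int CARD('a); X = fps_X in
     if [ind g c = 0] (mod 4) then
       3 * X + of_int (2 * s + 1) * X ^ 2 + of_int (3 * q - 4 * s ^ 2) * X ^ 3
     else if [ind g c = 1] (mod 4) then
       - X + of_int (2 * s - 8 * t + 1) * X ^ 2 + of_int (3 * q + 8 * s * t) * X ^ 3
     else if [ind g c = 2] (mod 4) then
       - X + of_int (- 6 * s + 1) * X ^ 2 + of_int (- 5 * q - 16 * t ^ 2) * X ^ 3
     else
       - X + of_int (2 * s + 8 * t + 1) * X ^ 2 + of_int (3 * q - 8 * s * t) * X ^ 3)"

end

theory Submission
  imports Defs "HOL-Number_Theory.Residues" Complex_Main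
begin

text \<open>
  Let \<open>\<chi>\<close> be the quartic character with \<open>\<chi>(g) = \<i>\<close> and \<open>T = \<chi> + \<chi>\<^sup>2 + \<chi>\<^sup>3\<close>, so that \<open>c\<close> has
  \<open>1 + T(c)\<close> fourth roots. Under additive convolution, \<open>\<chi>\<close>, \<open>\<chi>\<^sup>2\<close>, \<open>\<chi>\<^sup>3\<close> and
  \<open>\<delta>\<^sub>0 - 1/q\<close> span a four-dimensional algebra whose structure constants involve only \<open>q\<close>,
  \<open>\<chi>(-1)\<close> and the Jacobi sum \<open>J = J(\<chi>, \<chi>)\<close>. The deviation of \<open>M\<^bsub>n+1\<^esub>(y)\<close> from \<open>q\<^sup>n\<close> is a linear
  functional of the \<open>n\<close>-th convolution power of \<open>T\<close>, hence satisfies a linear recurrence of order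
  four. It remains to see that \<open>J = -s + 2 t \<i>\<close>: the norm of \<open>J\<close> is \<open>q\<close>, its real part is
  \<open>-1\<close> modulo 4, and, sending \<open>\<i>\<close> to \<open>g\<^bsup>(q-1)/4\<^esup>\<close>, the power sums of the field show that \<open>J\<close>
  reduces to 0 while its conjugate reduces to a binomial coefficient prime to \<open>p\<close> when
  \<open>p \<equiv> 1\<close> modulo 4; for \<open>p \<equiv> 3\<close> modulo 4 the prime \<open>p\<close> is inert in the Gaussian integers.
  When \<open>q \<equiv> 3\<close> modulo 4 the same argument applies with the quadratic character in place of \<open>T\<close>.
\<close>

section \<open>Recurrences and rational power series\<close>

lemma fps_eq_divideI:
  fixes F D N :: "rat fps"
  assumes "F * D = N" and "fps_nth D 0 \<noteq> 0"
  shows "F = N / D"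
proof -
  have "D \<noteq> 0" using assms(2) by auto
  then show ?thesis using assms(1) nonzero_mult_div_cancel_right[of D F] by simp
qed

text \<open>Multiplying by the denominator kills every coefficient from degree 4 on; below that,
  \<open>a 0 = 0\<close> leaves \<open>c2 * a 1\<close> in degree 3 as the only correction.\<close>

lemma fps_recurrence4:
  includes fps_syntax
  fixes a :: "nat \<Rightarrow> rat"
  assumes "a 0 = 0" and "\<And>n. a (n + 4) = c2 * a (n + 2) + c3 * a (n + 1) + c4 * a n"
  shows "Abs_fps a =
    (fps_const (a 1) * fps_X + fps_const (a 2) * fps_X ^ 2 + fps_const (a 3 - c2 * a 1) * fps_X ^ 3)
    / (1 - fps_const c2 * fps_X ^ 2 - fps_const c3 * fps_X ^ 3 - fps_const c4 * fps_X ^ 4)"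
proof (rule fps_eq_divideI)
  show "Abs_fps a * (1 - fps_const c2 * fps_X ^ 2 - fps_const c3 * fps_X ^ 3 - fps_const c4 * fps_X ^ 4)
    = fps_const (a 1) * fps_X + fps_const (a 2) * fps_X ^ 2 + fps_const (a 3 - c2 * a 1) * fps_X ^ 3"
    (is "?L = ?R")
  proof (rule fps_ext)
    fix n
    have L: "?L $ n = a n - c2 * (if n < 2 then 0 else a (n - 2)) - c3 * (if n < 3 then 0 else a (n - 3))
        - c4 * (if n < 4 then 0 else a (n - 4))"
    proof -
      have "?L = Abs_fps a - fps_const c2 * (Abs_fps a * fps_X ^ 2)
          - fps_const c3 * (Abs_fps a * fps_X ^ 3) - fps_const c4 * (Abs_fps a * fps_X ^ 4)"
        by (simp add: algebra_simps)
      then show ?thesis by (simp add: fps_X_power_mult_right_nth)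
    qed
    consider "n = 0" | "n = 1" | "n = 2" | "n = 3" | k where "n = k + 4"
    proof -
      have "n = 0 \<or> n = 1 \<or> n = 2 \<or> n = 3 \<or> n = (n - 4) + 4" by arith
      then show ?thesis using that by blast
    qed
    then show "?L $ n = ?R $ n"
    proof cases
      case 5
      have "?L $ n = 0" unfolding L using assms(2)[of k] by (simp add: 5)
      then show ?thesis by (simp add: 5 fps_X_power_nth)
    qed (unfold L, simp_all add: assms(1) fps_X_power_nth)
  qed
qed simp

lemma fps_geometric:
  includes fps_syntax
  fixes q :: rat
  shows "Abs_fps (\<lambda>n. if n \<ge> 1 then q ^ n else 0) =
    fps_const q * fps_X / (1 - fps_const q * fps_X)"
proof (rule fps_eq_divideI)
  show "Abs_fps (\<lambda>n. if n \<ge> 1 then q ^ n else 0) * (1 - fps_const q * fps_X) = fps_const q * fps_X"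
    (is "?F * _ = _")
  proof (rule fps_ext)
    fix n
    have "(?F * (1 - fps_const q * fps_X)) $ n = ?F $ n - q * (if n = 0 then 0 else ?F $ (n - 1))"
      by (simp add: algebra_simps mult.left_commute[of ?F])
    then show "(?F * (1 - fps_const q * fps_X)) $ n = (fps_const q * fps_X) $ n"
      by (cases n) (auto simp: fps_X_def)
  qed
qed simp

section \<open>Convolution over a finite field\<close>

definition conv :: "('a::{field,finite} \<Rightarrow> complex) \<Rightarrow> ('a \<Rightarrow> complex) \<Rightarrow> 'a \<Rightarrow> complex" where
  "conv f h c = (\<Sum>a\<in>UNIV. f a * h (c - a))"

lemma sum_UNIV_diff: "(\<Sum>a\<in>UNIV. F (c - a)) = (\<Sum>a\<in>UNIV. F a)" for c :: "'a::{field,finite}"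
  by (rule sum.reindex_bij_witness[of _ "\<lambda>a. c - a" "\<lambda>a. c - a"]) auto

lemma sum_UNIV_shift: "(\<Sum>a\<in>UNIV. F (a - c)) = (\<Sum>a\<in>UNIV. F a)" for c :: "'a::{field,finite}"
  by (rule sum.reindex_bij_witness[of _ "\<lambda>a. a + c" "\<lambda>a. a - c"]) auto

lemma sum_UNIV_mult:
  "d \<noteq> 0 \<Longrightarrow> (\<Sum>a\<in>UNIV. F (d * a)) = (\<Sum>a\<in>UNIV. F a)" for d :: "'a::{field,finite}"
  by (rule sum.reindex_bij_witness[of _ "\<lambda>a. a / d" "\<lambda>a. d * a"]) auto

lemma conv_commute: "conv f h = conv h f"
proof
  fix c
  have "conv h f c = (\<Sum>a\<in>UNIV. h (c - a) * f (c - (c - a)))"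
    unfolding conv_def by (rule sum_UNIV_diff[symmetric])
  then show "conv f h c = conv h f c" by (simp add: conv_def mult.commute)
qed

lemma conv_assoc: "conv (conv f h) k = conv f (conv h k)"
proof
  fix c
  have "conv (conv f h) k c = (\<Sum>a\<in>UNIV. \<Sum>b\<in>UNIV. f b * (h (a - b) * k (c - a)))"
    by (simp add: conv_def sum_distrib_right mult.assoc)
  also have "\<dots> = (\<Sum>b\<in>UNIV. \<Sum>a\<in>UNIV. f b * (h (a - b) * k ((c - b) - (a - b))))"
    by (subst sum.swap) simp
  also have "\<dots> = (\<Sum>b\<in>UNIV. \<Sum>a\<in>UNIV. f b * (h a * k ((c - b) - a)))"
    by (intro sum.cong refl sum_UNIV_shift)
  finally show "conv (conv f h) k c = conv f (conv h k) c"
    by (simp add: conv_def sum_distrib_left)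
qed

lemma conv_add_left: "conv (\<lambda>x. f x + h x) k c = conv f k c + conv h k c"
  by (simp add: conv_def sum.distrib algebra_simps)

lemma conv_scale_left: "conv (\<lambda>x. r * f x) k c = r * conv f k c"
  by (simp add: conv_def sum_distrib_left mult.assoc)

lemma conv_add_right: "conv f (\<lambda>x. h x + k x) c = conv f h c + conv f k c"
  by (simp add: conv_def sum.distrib algebra_simps)

lemma conv_scale_right: "conv f (\<lambda>x. r * k x) c = r * conv f k c"
  by (simp add: conv_def sum_distrib_left algebra_simps)

lemma sum_conv: "(\<Sum>c\<in>UNIV. conv f h c) = (\<Sum>a\<in>UNIV. f a) * (\<Sum>a\<in>UNIV. h a)"
proof -
  have "(\<Sum>c\<in>UNIV. conv f h c) = (\<Sum>a\<in>UNIV. f a * (\<Sum>c\<in>UNIV. h (c - a)))"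
    by (simp add: conv_def sum_distrib_left) (rule sum.swap)
  then show ?thesis by (simp add: sum_UNIV_shift sum_distrib_right)
qed

text \<open>The identity for convolution on functions with sum zero: the indicator of 0 minus its
  mean.\<close>

definition unit0 :: "'a::{field,finite} \<Rightarrow> complex" where
  "unit0 c = of_bool (c = 0) - 1 / of_nat CARD('a)"

lemma sum_unit0: "(\<Sum>a\<in>UNIV. unit0 a) = 0"
  by (simp add: unit0_def sum_subtractf)

lemma conv_const_right: "conv f (\<lambda>_. r) c = (\<Sum>a\<in>UNIV. f a) * r"
  by (simp add: conv_def sum_distrib_right)

lemma conv_unit0:
  assumes "(\<Sum>a\<in>UNIV. f a) = 0"
  shows "conv f unit0 = f"
proof
  fix c
  have "conv f unit0 c = (\<Sum>a\<in>UNIV. f a * of_bool (c = a)) - (\<Sum>a\<in>UNIV. f a) / of_nat CARD('a)"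
    by (simp add: conv_def unit0_def algebra_simps sum_subtractf sum_divide_distrib)
  then show "conv f unit0 c = f c" using assms by (simp add: of_bool_def if_distrib cong: if_cong)
qed

text \<open>Starting from \<open>unit0\<close> rather than the indicator of 0 keeps all powers of a
  function with sum zero inside the functions with sum zero.\<close>

fun cpow :: "('a::{field,finite} \<Rightarrow> complex) \<Rightarrow> nat \<Rightarrow> 'a \<Rightarrow> complex" where
  "cpow f 0 = unit0"
| "cpow f (Suc n) = conv f (cpow f n)"

lemma sum_cpow: "(\<Sum>a\<in>UNIV. f a) = 0 \<Longrightarrow> (\<Sum>a\<in>UNIV. cpow f n a) = 0"
  by (cases n) (simp_all add: sum_unit0 sum_conv)

section \<open>Counting solutions\<close>

definition roots4 :: "'a::{field,finite} \<Rightarrow> nat" where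
  "roots4 c = card {x. x ^ 4 = c}"

definition sols4 :: "nat \<Rightarrow> 'a::{field,finite} \<Rightarrow> nat" where
  "sols4 n c = card {x \<in> {1..n} \<rightarrow>\<^sub>E (UNIV :: 'a set). (\<Sum>i = 1..n. x i ^ 4) = c}"

text \<open>Grouping by the fibres of \<open>f\<close>; for \<open>f x = x ^ 4\<close> the fibre
  sizes are the numbers \<open>roots4\<close>.\<close>

lemma sum_pushforward:
  fixes f :: "'b::finite \<Rightarrow> 'a::finite" and h :: "'a \<Rightarrow> complex"
  shows "(\<Sum>x\<in>UNIV. h (f x)) = (\<Sum>a\<in>UNIV. of_nat (card {x. f x = a}) * h a)"
proof -
  have "(\<Sum>x\<in>UNIV. h (f x)) = (\<Sum>a\<in>UNIV. \<Sum>x\<in>{x. f x = a}. h (f x))"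
    using sum.group[of "UNIV :: 'b set" "UNIV :: 'a set" f "\<lambda>x. h (f x)"] by simp
  also have "\<dots> = (\<Sum>a\<in>UNIV. of_nat (card {x. f x = a}) * h a)"
    by (intro sum.cong refl) simp
  finally show ?thesis .
qed

text \<open>Members of the function space are \<open>undefined\<close> outside
  \<open>{1..n}\<close>, so updating at \<open>Suc n\<close> is a bijection from pairs of a last
  coordinate and a shorter tuple.\<close>

lemma card_PiE_Suc:
  fixes Q :: "(nat \<Rightarrow> 'a::finite) \<Rightarrow> bool"
  shows "card {x \<in> {1..Suc n} \<rightarrow>\<^sub>E UNIV. Q x} =
    (\<Sum>a\<in>UNIV. card {x \<in> {1..n} \<rightarrow>\<^sub>E UNIV. Q (x(Suc n := a))})"
proof -
  let ?h = "\<lambda>(a::'a, x). x(Suc n := a)"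
  let ?S = "SIGMA a:UNIV. {x \<in> {1..n} \<rightarrow>\<^sub>E UNIV. Q (x(Suc n := a))}"
  have fin: "finite ({1..n} \<rightarrow>\<^sub>E (UNIV :: 'a set))" by (rule finite_PiE) auto
  have "inj_on ?h (UNIV \<times> ({1..n} \<rightarrow>\<^sub>E UNIV))"
    by (rule inj_combinator) simp
  then have inj: "inj_on ?h ?S" by (rule inj_on_subset) auto
  have "{1..Suc n} = insert (Suc n) {1..n}" by auto
  then have "({1..Suc n} \<rightarrow>\<^sub>E (UNIV :: 'a set)) = ?h ` (UNIV \<times> ({1..n} \<rightarrow>\<^sub>E UNIV))"
    using PiE_insert_eq[of "Suc n" "{1..n}" "\<lambda>_. UNIV :: 'a set"] by simp
  then have "{x \<in> {1..Suc n} \<rightarrow>\<^sub>E UNIV. Q x} = ?h ` ?S" by (auto simp: image_iff)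
  then have "card {x \<in> {1..Suc n} \<rightarrow>\<^sub>E UNIV. Q x} = card ?S"
    using card_image[OF inj] by simp
  also have "\<dots> = (\<Sum>a\<in>UNIV. card {x \<in> {1..n} \<rightarrow>\<^sub>E UNIV. Q (x(Suc n := a))})"
    using fin by (subst card_SigmaI) auto
  finally show ?thesis .
qed

lemma sols4_0: "sols4 0 c = of_bool (c = 0)"
  by (auto simp: sols4_def)

lemma sols4_Suc: "sols4 (Suc n) c = (\<Sum>a\<in>UNIV. sols4 n (c - a ^ 4))"
  unfolding sols4_def
  by (subst card_PiE_Suc) (intro sum.cong refl arg_cong[where f = card], auto simp: algebra_simps)

lemma sols4_Suc_conv:
  "of_nat (sols4 (Suc n) c) = conv (\<lambda>a. of_nat (roots4 a)) (\<lambda>a. of_nat (sols4 n a)) c"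
  using sum_pushforward[of "\<lambda>a. of_nat (sols4 n (c - a))" "\<lambda>x. x ^ 4"]
  by (simp add: conv_def roots4_def sols4_Suc)

lemma M_eq_sum_sols4: "M (n + 1) y = (\<Sum>a\<in>UNIV. sols4 n (- y * a ^ 4))"
  unfolding sols4_def M_def
  by (simp only: Suc_eq_plus1[symmetric], subst card_PiE_Suc)
    (intro sum.cong refl arg_cong[where f = card], auto simp: eq_neg_iff_add_eq_0)

text \<open>Convolution with a constant sees only the sum of the other factor, so the constant 1 and
  \<open>T\<close> do not interact. The constant part is \<open>q ^ (n - 1)\<close>, written as a
  quotient so that \<open>n = 0\<close> is covered.\<close>

lemma sols4_eq_cpow:
  fixes T :: "'a::{field,finite} \<Rightarrow> complex"
  assumes roots: "\<And>c. of_nat (roots4 c) = 1 + T c" and T0: "(\<Sum>a\<in>UNIV. T a) = 0"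
  shows "of_nat (sols4 n c) = of_nat CARD('a) ^ n / of_nat CARD('a) + cpow T n c"
proof (induction n arbitrary: c)
  case 0
  then show ?case by (simp add: sols4_0 unit0_def)
next
  case (Suc n)
  have "of_nat (sols4 (Suc n) c) =
      conv (\<lambda>a. 1 + T a) (\<lambda>a. of_nat CARD('a) ^ n / of_nat CARD('a) + cpow T n a) c"
    by (simp add: sols4_Suc_conv roots Suc)
  also have "\<dots> = of_nat CARD('a) ^ n + conv T (cpow T n) c"
    by (simp add: conv_add_left conv_add_right conv_const_right T0)
      (simp add: conv_commute[of "\<lambda>_. 1"] conv_const_right sum_cpow[OF T0])
  finally show ?case by simp
qed

lemma sols4_scale:
  assumes "d \<noteq> 0"
  shows "sols4 n (d ^ 4 * c) = sols4 n c"
proof (induction n arbitrary: c)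
  case 0
  then show ?case using assms by (simp add: sols4_0)
next
  case (Suc n)
  have "sols4 (Suc n) (d ^ 4 * c) = (\<Sum>a\<in>UNIV. sols4 n (d ^ 4 * c - (d * a) ^ 4))"
    unfolding sols4_Suc by (rule sum_UNIV_mult[OF assms, symmetric])
  also have "\<dots> = (\<Sum>a\<in>UNIV. sols4 n (d ^ 4 * (c - a ^ 4)))"
    by (simp add: power_mult_distrib algebra_simps)
  finally show ?case by (simp add: Suc sols4_Suc)
qed

text \<open>The last coordinate is 0 or one of \<open>CARD('a) - 1\<close> units, and by
  \<open>sols4_scale\<close> all units contribute the same number.\<close>

lemma M_eq_sols4:
  fixes y :: "'a::{field,finite}"
  shows "M (n + 1) y = sols4 n (0 :: 'a) + (CARD('a) - 1) * sols4 n (- y)"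
proof -
  have "M (n + 1) y = sols4 n (0 :: 'a) + (\<Sum>a\<in>UNIV - {0}. sols4 n (- y * a ^ 4))"
    unfolding M_eq_sum_sols4 by (subst sum.remove[of _ 0]) (auto simp del: mult_minus_left)
  also have "(\<Sum>a\<in>UNIV - {0}. sols4 n (- y * a ^ 4)) = (\<Sum>a\<in>UNIV - {0::'a}. sols4 n (- y))"
    by (intro sum.cong refl) (use sols4_scale in \<open>simp add: mult.commute del: mult_minus_left\<close>)
  also have "\<dots> = (CARD('a) - 1) * sols4 n (- y)" by (simp add: card_Diff_singleton)
  finally show ?thesis .
qed

text \<open>The constant parts \<open>q ^ n / q\<close> and \<open>(q - 1) * q ^ n / q\<close> of
  the two terms add up to \<open>q ^ n\<close>.\<close>

lemma M_eq_cpow: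
  fixes T :: "'a::{field,finite} \<Rightarrow> complex"
  assumes "\<And>c. of_nat (roots4 c) = 1 + T c" and "(\<Sum>a\<in>UNIV. T a) = 0"
  shows "of_nat (M (n + 1) y) = of_nat CARD('a) ^ n + cpow T n 0 + (of_nat CARD('a) - 1) * cpow T n (- y)"
proof -
  have "1 \<le> CARD('a)" by (simp add: Suc_leI)
  then have "of_nat (M (n + 1) y) = of_nat (sols4 n (0 :: 'a)) + (of_nat CARD('a) - 1) * (of_nat (sols4 n (- y)) :: complex)"
    unfolding M_eq_sols4 by simp
  then show ?thesis
    unfolding sols4_eq_cpow[of T, OF assms] by (simp add: algebra_simps diff_divide_distrib)
qed

section \<open>Characters attached to a generator\<close>

text \<open>Multiplication by \<open>x\<close> permutes the nonzero elements, so it does not change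
  their product.\<close>

lemma power_card_minus_one:
  fixes x :: "'a::{field,finite}"
  assumes "x \<noteq> 0"
  shows "x ^ (CARD('a) - 1) = 1"
proof -
  have "bij_betw ((*) x) (UNIV - {0}) (UNIV - {0})"
    by (rule bij_betw_byWitness[where f' = "\<lambda>a. a / x"]) (use assms in auto)
  then have "(\<Prod>a\<in>UNIV - {0}. x * a) = (\<Prod>a\<in>UNIV - {0}. a)"
    by (rule prod.reindex_bij_betw)
  then show ?thesis
    by (simp add: prod.distrib card_Diff_singleton)
qed

lemma power_eq_if_cong:
  fixes z :: "'b::comm_ring_1"
  assumes "z ^ n = 1" and "[i = j] (mod n)"
  shows "z ^ i = z ^ j"
proof -
  have "z ^ i = z ^ (i mod n)" for i
    by (metis assms(1) mod_mult_div_eq mult_1_right power_add power_mult power_one)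
  then show ?thesis using assms(2) by (metis cong_def)
qed

locale field_generator =
  fixes g :: "'a::{field,finite}"
  assumes generates: "generates_units g"
begin

lemma card_ge_2: "CARD('a) \<ge> 2"
proof -
  have "card {0, 1 :: 'a} \<le> CARD('a)" by (rule card_mono) auto
  then show ?thesis by simp
qed

lemma gen_nonzero: "g \<noteq> 0"
proof -
  have "g powi 1 \<in> UNIV - {0}" using generates unfolding generates_units_def by blast
  then show ?thesis by simp
qed

text \<open>An integer exponent can be reduced modulo \<open>CARD('a) - 1\<close> to a natural
  number; injectivity then follows by counting.\<close>

lemma bij_gen: "bij_betw (\<lambda>i. g ^ i) {..<CARD('a) - 1} (UNIV - {0})"
proof -
  let ?n = "CARD('a) - 1"
  have n: "?n > 0" using card_ge_2 by simp
  have "c \<in> (\<lambda>i. g ^ i) ` {..<?n}" if "c \<noteq> 0" for c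
  proof -
    have "c \<in> range (\<lambda>i::int. g powi i)"
      using generates that unfolding generates_units_def by simp
    then obtain k :: int where k: "c = g powi k" by blast
    have "c = g powi (k mod ?n + ?n * (k div ?n))" unfolding k by (simp add: mult.commute)
    also have "\<dots> = g powi (k mod ?n) * (g powi ?n) powi (k div ?n)"
      by (simp only: power_int_add[OF disjI1[OF gen_nonzero]] power_int_mult)
    also have "\<dots> = g ^ nat (k mod ?n)"
      using n by (simp add: power_card_minus_one[OF gen_nonzero] power_int_nonneg_exp
          del: of_nat_diff One_nat_def)
    finally show ?thesis using n
      by (intro image_eqI[of _ _ "nat (k mod ?n)"]) (auto simp: nat_less_iff simp del: of_nat_diff)
  qed
  then have im: "(\<lambda>i. g ^ i) ` {..<?n} = UNIV - {0}" using gen_nonzero by auto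
  moreover have "inj_on (\<lambda>i. g ^ i) {..<?n}"
    by (rule eq_card_imp_inj_on) (simp_all add: im card_Diff_singleton del: One_nat_def)
  ultimately show ?thesis by (simp add: bij_betw_def)
qed

lemma gen_power_eq_iff: "g ^ i = g ^ j \<longleftrightarrow> [i = j] (mod CARD('a) - 1)"
proof
  let ?n = "CARD('a) - 1"
  have n: "?n > 0" using card_ge_2 by simp
  assume eq: "g ^ i = g ^ j"
  have "g ^ i = g ^ (i mod ?n)" for i
    by (rule power_eq_if_cong[OF power_card_minus_one[OF gen_nonzero]]) (simp add: cong_def)
  then have "g ^ (i mod ?n) = g ^ (j mod ?n)" using eq by metis
  then have "i mod ?n = j mod ?n"
    using bij_gen n by (auto simp: bij_betw_def inj_on_def)
  then show "[i = j] (mod ?n)" by (simp add: cong_def)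
qed (rule power_eq_if_cong[OF power_card_minus_one[OF gen_nonzero]])

lemma ind_props:
  assumes "c \<noteq> 0"
  shows "ind g c < CARD('a) - 1" and "g ^ ind g c = c"
proof -
  have "\<exists>!i. i \<in> {..<CARD('a) - 1} \<and> g ^ i = c"
    using bij_gen assms unfolding bij_betw_def inj_on_def
    by (metis (no_types, lifting) DiffI UNIV_I imageE singletonD)
  moreover have "{0..CARD('a) - 2} = {..<CARD('a) - 1}" using card_ge_2 by auto
  ultimately have "\<exists>!i. i \<in> {0..CARD('a) - 2} \<and> g ^ i = c" by simp
  from theI'[OF this] show "ind g c < CARD('a) - 1" and "g ^ ind g c = c"
    unfolding ind_def using card_ge_2 by auto
qed

lemma ind_gen_power: "[ind g (g ^ k) = k] (mod CARD('a) - 1)"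
  using ind_props(2)[of "g ^ k"] gen_nonzero gen_power_eq_iff by simp

text \<open>The element squares to 1, and it is not 1 since its exponent lies strictly between 0 and
  the order of \<open>g\<close>.\<close>

lemma minus_one_eq:
  assumes "odd CARD('a)"
  shows "g ^ ((CARD('a) - 1) div 2) = - 1"
proof -
  let ?h = "(CARD('a) - 1) div 2"
  have h: "CARD('a) - 1 = 2 * ?h" "?h > 0" using assms card_ge_2 by (auto elim!: oddE)
  have "(g ^ ?h) ^ 2 = 1"
    using power_card_minus_one[OF gen_nonzero] h(1) by (metis mult.commute power_mult)
  then have "g ^ ?h = 1 \<or> g ^ ?h = - 1" by (simp add: power2_eq_1_iff)
  moreover have "g ^ ?h \<noteq> g ^ 0"
    unfolding gen_power_eq_iff using h by (auto simp: cong_def)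
  ultimately show ?thesis by simp
qed

section \<open>Multiplicative characters with values in a commutative ring\<close>

definition unit_root :: "'b::comm_ring_1 \<Rightarrow> bool" where
  "unit_root z \<longleftrightarrow> z ^ (CARD('a) - 1) = 1"

lemma unit_root_mult: "unit_root z \<Longrightarrow> unit_root w \<Longrightarrow> unit_root (z * w)"
  by (simp add: unit_root_def power_mult_distrib)

text \<open>The character sending \<open>g\<close> to \<open>z\<close>, multiplicative when
  \<open>unit_root z\<close> holds. As \<open>z\<close> may come from any commutative ring, complex
  characters and characters with values in the field itself are treated alike; even the trivial one
  is 0 at 0.\<close>

definition chi :: "'b::comm_ring_1 \<Rightarrow> 'a \<Rightarrow> 'b" where
  "chi z c = (if c = 0 then 0 else z ^ ind g c)"

lemma chi_0 [simp]: "chi z 0 = 0"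
  by (simp add: chi_def)

lemma chi_gen_power: "unit_root z \<Longrightarrow> chi z (g ^ k) = z ^ k"
  using power_eq_if_cong[OF _ ind_gen_power, of z k] gen_nonzero by (simp add: chi_def unit_root_def)

lemma chi_1 [simp]: "unit_root z \<Longrightarrow> chi z 1 = 1"
  using chi_gen_power[of z 0] by simp

lemma chi_mult:
  assumes "unit_root z"
  shows "chi z (c * d) = chi z c * chi z d"
proof (cases "c = 0 \<or> d = 0")
  case False
  then have "chi z (c * d) = chi z (g ^ (ind g c + ind g d))"
    by (simp add: power_add ind_props)
  also have "\<dots> = z ^ ind g c * z ^ ind g d"
    unfolding chi_gen_power[OF assms] by (rule power_add)
  finally show ?thesis using False by (simp add: chi_def)
qed auto

lemma chi_mult_arg: "chi z c * chi w c = chi (z * w) c"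
  by (simp add: chi_def power_mult_distrib)

text \<open>Substituting \<open>g * a\<close> for \<open>a\<close> multiplies the sum by
  \<open>z\<close>.\<close>

lemma sum_chi:
  fixes z :: "'b::idom"
  assumes "unit_root z" and "z \<noteq> 1"
  shows "(\<Sum>a\<in>UNIV. chi z a) = 0"
proof -
  have "(\<Sum>a\<in>UNIV. chi z a) = (\<Sum>a\<in>UNIV. chi z (g * a))"
    by (rule sum_UNIV_mult[OF gen_nonzero, symmetric])
  also have "\<dots> = z * (\<Sum>a\<in>UNIV. chi z a)"
    using chi_gen_power[OF assms(1), of 1] by (simp add: chi_mult[OF assms(1)] sum_distrib_left)
  finally have "(z - 1) * (\<Sum>a\<in>UNIV. chi z a) = 0" by (simp add: left_diff_distrib)
  then show ?thesis using assms(2) by simp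
qed

lemma sum_chi_one: "(\<Sum>a\<in>UNIV. chi 1 a) = (of_nat CARD('a) - 1 :: 'b::idom)"
proof -
  have "(\<Sum>a\<in>UNIV. chi 1 a) = (\<Sum>a\<in>UNIV - {0::'a}. 1 :: 'b)"
    by (subst sum.remove[of _ 0]) (auto simp: chi_def)
  also have "\<dots> = of_nat (CARD('a) - 1)" by (simp add: card_Diff_singleton)
  finally show ?thesis using card_ge_2 by (simp add: of_nat_diff)
qed

definition jac :: "'b::comm_ring_1 \<Rightarrow> 'b \<Rightarrow> 'b" where
  "jac z w = (\<Sum>a\<in>UNIV. chi z a * chi w (1 - a))"

text \<open>Substituting \<open>c * a\<close> for \<open>a\<close> pulls the value at
  \<open>c\<close> out of both characters.\<close>

lemma conv_chi_nonzero:
  assumes "unit_root z" and "unit_root w" and "c \<noteq> 0"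
  shows "conv (chi z) (chi w) c = jac z w * chi (z * w) c"
proof -
  have "conv (chi z) (chi w) c = (\<Sum>a\<in>UNIV. chi z (c * a) * chi w (c - c * a))"
    unfolding conv_def by (rule sum_UNIV_mult[OF assms(3), symmetric])
  also have "\<dots> = (\<Sum>a\<in>UNIV. chi z (c * a) * chi w (c * (1 - a)))"
    by (simp add: algebra_simps)
  also have "\<dots> = (\<Sum>a\<in>UNIV. chi (z * w) c * (chi z a * chi w (1 - a)))"
    by (simp add: chi_mult[OF assms(1)] chi_mult[OF assms(2)] chi_mult_arg[symmetric] mult_ac)
  finally show ?thesis by (simp add: jac_def sum_distrib_left mult.commute)
qed

lemma conv_chi_zero:
  assumes "unit_root w"
  shows "conv (chi z) (chi w) 0 = chi w (- 1) * (\<Sum>a\<in>UNIV. chi (z * w) a)"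
proof -
  have "chi z a * chi w (- a) = chi w (- 1) * chi (z * w) a" for a
    using chi_mult[OF assms, of "- 1" a] by (simp add: mult_ac flip: chi_mult_arg)
  then show ?thesis
    by (simp add: conv_def flip: sum_distrib_left)
qed

lemma conv_chi:
  assumes "unit_root z" and "unit_root w" and "z * w \<noteq> 1"
  shows "conv (chi z) (chi w) c = jac z w * chi (z * w) c"
proof (cases "c = 0")
  case True
  have "unit_root (z * w)" using assms by (simp add: unit_root_mult)
  with True assms show ?thesis by (simp add: conv_chi_zero sum_chi)
qed (simp add: conv_chi_nonzero assms)

text \<open>The convolution has sum zero and is constant away from 0, so it is determined by its
  value at 0.\<close>

lemma conv_chi_inverse:
  assumes "unit_root z" and "unit_root w" and "z * w = 1" and "z \<noteq> 1"
  shows "conv (chi z) (chi w) c = chi w (- 1) * of_nat CARD('a) * unit0 c"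
proof -
  let ?q = "of_nat CARD('a) :: complex"
  have q: "?q \<noteq> 1" "?q \<noteq> 0" using card_ge_2 by simp_all
  have at0: "conv (chi z) (chi w) 0 = chi w (- 1) * (?q - 1)"
    by (simp add: conv_chi_zero assms sum_chi_one)
  have away: "conv (chi z) (chi w) c = jac z w" if "c \<noteq> 0" for c
    using that by (simp add: conv_chi_nonzero assms chi_def)
  have "0 = (\<Sum>c\<in>UNIV. conv (chi z) (chi w) c)"
    by (simp add: sum_conv sum_chi assms)
  also have "\<dots> = chi w (- 1) * (?q - 1) + (\<Sum>c\<in>UNIV - {0::'a}. jac z w)"
    by (subst sum.remove[of _ 0]) (auto simp: at0 away)
  also have "\<dots> = (?q - 1) * (chi w (- 1) + jac z w)"
    using card_ge_2 by (simp add: card_Diff_singleton of_nat_diff algebra_simps)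
  finally have "jac z w = - chi w (- 1)" using q by (simp add: eq_neg_iff_add_eq_0 add.commute)
  then show ?thesis using q by (cases "c = 0") (auto simp: at0 away unit0_def field_simps)
qed

text \<open>With values in the field itself the characters are the power maps; for
  \<open>j > 0\<close> both sides are 0 at 0.\<close>

lemma chi_gen_power_eq_power:
  assumes "j > 0"
  shows "chi (g ^ j) a = a ^ j"
proof (cases "a = 0")
  case False
  then have "a ^ j = (g ^ ind g a) ^ j" by (simp add: ind_props)
  then show ?thesis using False by (simp add: chi_def mult.commute flip: power_mult)
qed (use assms in simp)

text \<open>A power sum is a character sum in the field: the trivial character yields
  \<open>q - 1\<close>, which is \<open>- 1\<close> because the characteristic divides
  \<open>q\<close>.\<close>

lemma sum_power:
  assumes "j > 0"
  shows "(\<Sum>x\<in>UNIV. x ^ j) = (if (CARD('a) - 1) dvd j then - 1 else 0 :: 'a)"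
proof -
  have c: "unit_root (g ^ j)"
    unfolding unit_root_def by (metis power_card_minus_one gen_nonzero mult.commute power_mult power_one)
  have sum: "(\<Sum>x\<in>UNIV. x ^ j) = (\<Sum>x\<in>UNIV. chi (g ^ j) x)"
    by (rule sum.cong[OF refl]) (rule chi_gen_power_eq_power[OF assms, symmetric])
  have iff: "g ^ j = 1 \<longleftrightarrow> (CARD('a) - 1) dvd j"
    using gen_power_eq_iff[of j 0] by (simp add: cong_0_iff)
  have "of_nat CARD('a) = (0 :: 'a)" using CHAR_dvd_CARD by (simp add: of_nat_eq_0_iff_char_dvd)
  then show ?thesis
    using sum sum_chi[OF c] sum_chi_one[where 'b = 'a] iff by auto
qed

end

section \<open>Fourth roots and the quartic character\<close>

lemma mod_4_cases: "n mod 4 = 0 \<or> n mod 4 = 1 \<or> n mod 4 = 2 \<or> n mod 4 = 3" for n :: nat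
proof -
  have "n mod 4 < 4" by simp
  then show ?thesis by linarith
qed

lemma roots4_0: "roots4 (0 :: 'a::{field,finite}) = 1"
  by (simp add: roots4_def)

text \<open>Here \<open>- 1\<close> is a nonsquare, so the nonzero fourth powers are exactly the
  nonzero squares, and each has just two fourth roots.\<close>

lemma (in field_generator) roots4_if_3_mod_4:
  assumes "[CARD('a) = 3] (mod 4)"
  shows "of_nat (roots4 c) = (1 + chi (- 1) c :: complex)"
proof (cases "c = 0")
  case False
  have m: "CARD('a) mod 4 = 3" using assms by (simp add: cong_def)
  then have odd: "odd CARD('a)" by presburger
  let ?n = "CARD('a) - 1"
  obtain k where "CARD('a) = 4 * k + 3" using m by (metis mult_div_mod_eq)
  then have "?n = 2 + 4 * k" by simp
  then have n: "?n mod 4 = 2" by (simp only: mod_mult_self2) simp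
  have "2 dvd b \<and> odd (b div 2)" if "b mod 4 = 2" for b :: nat using that by presburger
  from this[OF n] have n2: "2 dvd ?n" "odd (?n div 2)" by auto
  show ?thesis
  proof (cases "even (ind g c)")
    case True
    \<comment> \<open>The order of \<open>g\<close> is 2 modulo 4, so one of the exponents
      \<open>ind g c\<close> and \<open>ind g c + ?n\<close> is divisible by 4.\<close>
    define j where "j = (if 4 dvd ind g c then ind g c else ind g c + ?n)"
    have "4 dvd a + b" if "even a" "b mod 4 = 2" "\<not> 4 dvd a" for a b :: nat
      using that by presburger
    from this[of "ind g c" ?n] have "4 dvd j" using True n by (simp add: j_def)
    moreover have "g ^ j = c"
      using False by (simp add: j_def power_add ind_props power_card_minus_one[OF gen_nonzero] del: One_nat_def)
    ultimately obtain i where i: "(g ^ i) ^ 4 = c"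
      by (metis dvd_def mult.commute power_mult)
    define d where "d = g ^ i"
    have d: "d \<noteq> 0" "d ^ 4 = c" using i gen_nonzero by (auto simp: d_def)
    \<comment> \<open>A square has an even exponent, whereas \<open>- d\<^sup>2\<close> has the odd
      exponent \<open>?n div 2 + 2 * i\<close>.\<close>
    have sq: "x\<^sup>2 \<noteq> - d\<^sup>2" for x
    proof
      assume eq: "x\<^sup>2 = - d\<^sup>2"
      then have "x \<noteq> 0" using d by auto
      then have "g ^ (2 * ind g x) = x\<^sup>2"
        by (simp add: ind_props mult.commute[of 2] power_mult)
      also have "\<dots> = g ^ (?n div 2) * g ^ (2 * i)"
        unfolding eq minus_one_eq[OF odd] d_def by (simp add: mult.commute[of 2] power_mult)
      finally have "g ^ (2 * ind g x) = g ^ (?n div 2 + 2 * i)" by (simp only: power_add)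
      then have "[2 * ind g x = ?n div 2 + 2 * i] (mod ?n)" unfolding gen_power_eq_iff .
      then have "[2 * ind g x = ?n div 2 + 2 * i] (mod 2)"
        by (rule cong_dvd_modulus_nat) (rule n2)
      then have "even (?n div 2)" by (metis cong_def cong_dvd_iff dvd_add_left_iff dvd_triv_left)
      then show False using n2 by simp
    qed
    have "x ^ 4 = c \<longleftrightarrow> x = d \<or> x = - d" for x
    proof -
      have "x ^ 4 - d ^ 4 = (x - d) * (x + d) * (x\<^sup>2 + d\<^sup>2)"
        by (simp add: algebra_simps eval_nat_numeral)
      moreover have "x\<^sup>2 + d\<^sup>2 \<noteq> 0" using sq[of x] by (simp add: eq_neg_iff_add_eq_0)
      moreover have "x ^ 4 = c \<longleftrightarrow> x ^ 4 - d ^ 4 = 0" using d(2) by simp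
      ultimately show ?thesis by (simp add: eq_neg_iff_add_eq_0)
    qed
    then have "{x. x ^ 4 = c} = {d, - d}" by auto
    moreover have "d \<noteq> - d"
    proof
      assume "d = - d"
      then have "d * d = - (d * d)" by (metis mult_minus_left)
      then show False using sq[of d] by (simp add: power2_eq_square)
    qed
    ultimately have "roots4 c = 2" by (simp add: roots4_def)
    then show ?thesis using True False by (simp add: chi_def)
  next
    case odd: False
    have "x ^ 4 \<noteq> c" for x
    proof
      assume eq: "x ^ 4 = c"
      then have "x \<noteq> 0" using False by auto
      then have "g ^ (4 * ind g x) = g ^ ind g c"
        using eq ind_props(2) False by (simp add: mult.commute[of 4] power_mult)
      then have "[4 * ind g x = ind g c] (mod ?n)" unfolding gen_power_eq_iff .
      then have "[4 * ind g x = ind g c] (mod 2)"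
        by (rule cong_dvd_modulus_nat) (rule n2)
      then show False unfolding cong_def using odd by presburger
    qed
    then show ?thesis using False odd by (simp add: roots4_def chi_def)
  qed
qed (simp add: roots4_0)

section \<open>The quartic character when \<open>q\<close> is 1 modulo 4\<close>

locale quartic_generator = field_generator +
  assumes four_dvd: "4 dvd CARD('a) - 1"
begin

lemma odd_card: "odd CARD('a)"
  using four_dvd card_ge_2 by presburger

lemma unit_root_if_power4: "z ^ 4 = 1 \<Longrightarrow> unit_root z"
  using four_dvd by (auto simp: unit_root_def dvd_def power_mult simp del: One_nat_def)

lemma power4_if_square:
  fixes \<iota> :: "'b::comm_ring_1"
  assumes "\<iota> * \<iota> = - 1"
  shows "\<iota> ^ 4 = 1"
proof -
  have "\<iota> ^ 4 = (\<iota> * \<iota>) * (\<iota> * \<iota>)" by (simp add: eval_nat_numeral mult_ac)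
  then show ?thesis by (simp add: assms)
qed

lemma unit_roots [simp]: "unit_root \<i>" "unit_root (- \<i>)" "unit_root (- 1 :: complex)"
  by (intro unit_root_if_power4, simp)+

text \<open>\<open>re_chi\<close> and \<open>im_chi\<close> are the real and imaginary parts of the
  quartic character; as integers they can be mapped into any ring.\<close>

definition re_chi :: "'a \<Rightarrow> int" where
  "re_chi c = (if c = 0 then 0 else if ind g c mod 4 = 0 then 1 else if ind g c mod 4 = 2 then - 1 else 0)"

definition im_chi :: "'a \<Rightarrow> int" where
  "im_chi c = (if c = 0 then 0 else if ind g c mod 4 = 1 then 1 else if ind g c mod 4 = 3 then - 1 else 0)"

text \<open>Any square root of \<open>- 1\<close>, complex or in the finite field, gives the same
  integer coordinates; this is what allows \<open>\<i>\<close> to be replaced by an element of the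
  field.\<close>

lemma chi_eq_re_im:
  fixes \<iota> :: "'b::comm_ring_1"
  assumes "\<iota> * \<iota> = - 1"
  shows "chi \<iota> c = of_int (re_chi c) + \<iota> * of_int (im_chi c)"
proof -
  have "\<iota> ^ ind g c = \<iota> ^ (ind g c mod 4)"
    by (rule power_eq_if_cong[OF power4_if_square[OF assms]]) (simp add: cong_def)
  moreover have "\<iota> ^ 2 = - 1" "\<iota> ^ 3 = - \<iota>"
    using assms by (simp_all add: eval_nat_numeral mult.assoc)
  moreover note mod_4_cases[of "ind g c"]
  ultimately show ?thesis by (auto simp: chi_def re_chi_def im_chi_def)
qed

text \<open>The quadratic character is the square of the quartic one, and one of the two coordinates
  is always 0.\<close>

lemma chi_quadratic: "chi (- 1) c = of_int ((re_chi c)\<^sup>2 - (im_chi c)\<^sup>2)"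
proof -
  note mod_4_cases[of "ind g c"]
  moreover have "even (ind g c) \<longleftrightarrow> even (ind g c mod 4)" by presburger
  ultimately show ?thesis by (auto simp: chi_def re_chi_def im_chi_def)
qed

definition quart :: "'a \<Rightarrow> complex" where
  "quart c = chi \<i> c + chi (- 1) c + chi (- \<i>) c"

lemma sum_quart: "(\<Sum>a\<in>UNIV. quart a) = 0"
  by (simp add: quart_def sum.distrib sum_chi complex_eq_iff)

lemma gen_quarter: "g ^ ((CARD('a) - 1) div 4) * g ^ ((CARD('a) - 1) div 4) = - 1"
proof -
  have "(CARD('a) - 1) div 4 + (CARD('a) - 1) div 4 = (CARD('a) - 1) div 2"
    using four_dvd by auto
  then show ?thesis using minus_one_eq[OF odd_card] by (metis power_add)
qed

lemma quart_eq: "c \<noteq> 0 \<Longrightarrow> quart c = (if 4 dvd ind g c then 3 else - 1)"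
proof -
  assume "c \<noteq> 0"
  moreover note mod_4_cases[of "ind g c"]
  ultimately show ?thesis
    by (auto simp: quart_def chi_eq_re_im[of "\<i>"] chi_eq_re_im[of "- \<i>"] chi_quadratic re_chi_def
        im_chi_def dvd_eq_mod_eq_0)
qed

text \<open>When 4 divides the index, the fourth roots are one root \<open>d\<close> times the four
  fourth roots of unity; otherwise there are none, since 4 divides the order of
  \<open>g\<close>.\<close>

lemma roots4_eq_quart: "of_nat (roots4 c) = 1 + quart c"
proof (cases "c = 0")
  case False
  show ?thesis
  proof (cases "4 dvd ind g c")
    case True
    then obtain i where "ind g c = 4 * i" by (auto simp: dvd_def)
    define d where "d = g ^ i"
    define \<iota> where "\<iota> = g ^ ((CARD('a) - 1) div 4)"
    have \<iota>: "\<iota> * \<iota> = - 1" unfolding \<iota>_def by (rule gen_quarter)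
    have d: "d \<noteq> 0" "d ^ 4 = c"
      using ind_props(2)[OF False] gen_nonzero \<open>ind g c = 4 * i\<close>
      by (auto simp: d_def mult.commute simp flip: power_mult)
    have two: "(1 :: 'a) \<noteq> - 1"
    proof -
      have "g ^ 0 \<noteq> g ^ ((CARD('a) - 1) div 2)"
        unfolding gen_power_eq_iff using card_ge_2 odd_card
        by (auto simp: cong_def elim!: oddE)
      then show ?thesis unfolding minus_one_eq[OF odd_card] by simp
    qed
    have "x ^ 4 - d ^ 4 = (x - d) * (x + d) * ((x - \<iota> * d) * (x + \<iota> * d))" for x
    proof -
      have "(x - \<iota> * d) * (x + \<iota> * d) = x * x - (\<iota> * \<iota>) * (d * d)"
        by (simp add: algebra_simps)
      then have e: "(x - \<iota> * d) * (x + \<iota> * d) = x * x + d * d" by (simp add: \<iota>)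
      show ?thesis unfolding e by (simp add: algebra_simps eval_nat_numeral)
    qed
    then have "x ^ 4 = c \<longleftrightarrow> x = d \<or> x = - d \<or> x = \<iota> * d \<or> x = - (\<iota> * d)" for x
      using d(2) by (metis add_eq_0_iff2 eq_iff_diff_eq_0 mult_eq_0_iff)
    then have set: "{x. x ^ 4 = c} = {d, - d, \<iota> * d, - (\<iota> * d)}" by auto
    have \<iota>1: "\<iota> \<noteq> 1" "\<iota> \<noteq> - 1" using \<iota> two by auto
    have self: "u \<noteq> - u" if "u \<noteq> 0" for u :: 'a
    proof
      assume "u = - u"
      then have "(1 + 1) * u = 0" by (simp add: eq_neg_iff_add_eq_0)
      then show False using two that by (metis eq_neg_iff_add_eq_0 mult_eq_0_iff)
    qed
    have neq: "u * d \<noteq> v * d" if "u \<noteq> v" for u v using d(1) that by simp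
    have "d \<noteq> \<iota> * d" "d \<noteq> - (\<iota> * d)" "- d \<noteq> \<iota> * d" "- d \<noteq> - (\<iota> * d)" "\<iota> * d \<noteq> 0"
      using neq[of 1 \<iota>] neq[of 1 "- \<iota>"] neq[of "- 1" \<iota>] neq[of "- 1" "- \<iota>"] neq[of \<iota> 0] \<iota> \<iota>1
      by (auto simp: equation_minus_iff[of 1])
    then have "card {d, - d, \<iota> * d, - (\<iota> * d)} = 4"
      using self[OF d(1)] self[of "\<iota> * d"] by (simp add: card_insert_if)
    then have "roots4 c = 4" using set by (simp add: roots4_def)
    then show ?thesis using True False by (simp add: quart_eq)
  next
    case ndvd: False
    have "x ^ 4 \<noteq> c" for x
    proof
      assume eq: "x ^ 4 = c"
      then have "x \<noteq> 0" using False by auto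
      then have "g ^ (4 * ind g x) = g ^ ind g c"
        using eq ind_props(2) False by (simp add: mult.commute[of 4] power_mult)
      then have "[4 * ind g x = ind g c] (mod CARD('a) - 1)" unfolding gen_power_eq_iff .
      then have "[4 * ind g x = ind g c] (mod 4)"
        by (rule cong_dvd_modulus_nat) (rule four_dvd)
      then show False unfolding cong_def using ndvd by presburger
    qed
    then show ?thesis using False ndvd by (simp add: roots4_def quart_eq)
  qed
qed (simp add: roots4_0 quart_def)

end

section \<open>The quartic Jacobi sum\<close>

context quartic_generator
begin

text \<open>\<open>jre\<close> and \<open>jim\<close> are the coordinates of the quartic Jacobi sum,
  defined as integers so that they can also be reduced in the finite field.\<close>

definition jre :: int where
  "jre = (\<Sum>a\<in>UNIV. re_chi a * re_chi (1 - a) - im_chi a * im_chi (1 - a))"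

definition jim :: int where
  "jim = (\<Sum>a\<in>UNIV. re_chi a * im_chi (1 - a) + im_chi a * re_chi (1 - a))"

lemma jac_eq:
  fixes \<iota> :: "'b::comm_ring_1"
  assumes "\<iota> * \<iota> = - 1"
  shows "jac \<iota> \<iota> = of_int jre + \<iota> * of_int jim"
proof -
  have "chi \<iota> a * chi \<iota> (1 - a) =
      of_int (re_chi a * re_chi (1 - a) - im_chi a * im_chi (1 - a))
      + \<iota> * of_int (re_chi a * im_chi (1 - a) + im_chi a * re_chi (1 - a))" for a
  proof -
    have "chi \<iota> a * chi \<iota> (1 - a) = of_int (re_chi a) * of_int (re_chi (1 - a))
        + (\<iota> * \<iota>) * (of_int (im_chi a) * of_int (im_chi (1 - a)))
        + \<iota> * (of_int (re_chi a) * of_int (im_chi (1 - a)) + of_int (im_chi a) * of_int (re_chi (1 - a)))"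
      unfolding chi_eq_re_im[OF assms] by (simp add: algebra_simps)
    then show ?thesis unfolding assms by simp
  qed
  then show ?thesis by (simp only: jac_def jre_def jim_def of_int_sum sum_distrib_left sum.distrib[symmetric])
qed

text \<open>The value of the quartic character at \<open>- 1\<close>: it is 1 for \<open>q\<close>
  congruent to 1 modulo 8 and \<open>- 1\<close> for \<open>q\<close> congruent to 5.\<close>

definition sgn4 :: int where
  "sgn4 = (- 1) ^ ((CARD('a) - 1) div 4)"

lemma sgn4_square: "sgn4 * sgn4 = 1"
  by (simp add: sgn4_def flip: power_mult_distrib)

lemma chi_minus_one:
  "chi \<i> (- 1) = of_int sgn4" "chi (- \<i>) (- 1) = of_int sgn4" "chi (- 1) (- 1) = (1 :: complex)"
proof -
  have h: "(CARD('a) - 1) div 2 = 2 * ((CARD('a) - 1) div 4)" using four_dvd by auto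
  have "chi z (- 1) = (z ^ 2) ^ ((CARD('a) - 1) div 4)" if "unit_root z" for z :: complex
    unfolding minus_one_eq[OF odd_card, symmetric] chi_gen_power[OF that] h by (simp only: power_mult)
  then show "chi \<i> (- 1) = of_int sgn4" "chi (- \<i>) (- 1) = of_int sgn4" "chi (- 1) (- 1) = (1 :: complex)"
    by (simp_all add: sgn4_def)
qed

abbreviation "J \<equiv> jac \<i> \<i>"
abbreviation "J' \<equiv> jac (- \<i>) (- \<i>)"

lemma J_eq: "J = of_int jre + \<i> * of_int jim" "J' = of_int jre - \<i> * of_int jim"
  using jac_eq[of \<i>] jac_eq[of "- \<i>"] by simp_all

lemma unit0_0: "(unit0 (0::'a) :: complex) \<noteq> 0"
  using card_ge_2 by (simp add: unit0_def)

lemma conv_square: "conv (chi \<i>) (chi \<i>) = (\<lambda>c. J * chi (- 1) c)"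
  "conv (chi (- \<i>)) (chi (- \<i>)) = (\<lambda>c. J' * chi (- 1) c)"
  "conv (chi (- 1)) (chi (- 1)) = (\<lambda>c. of_nat CARD('a) * unit0 c)"
  "conv (chi \<i>) (chi (- \<i>)) = (\<lambda>c. of_int sgn4 * of_nat CARD('a) * unit0 c)"
  by (auto simp: conv_chi conv_chi_inverse chi_minus_one complex_eq_iff)

text \<open>Evaluating \<open>\<chi> * \<chi> * \<chi>\<^sup>2\<close> in two ways relates \<open>J(\<chi>, \<chi>\<^sup>2)\<close> to \<open>J(\<chi>, \<chi>)\<close>.\<close>

lemma jac_quadratic: "jac \<i> (- 1) = of_int sgn4 * J" "jac (- \<i>) (- 1) = of_int sgn4 * J'"
proof -
  have sg: "of_int sgn4 * of_int sgn4 = (1 :: complex)"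
    using sgn4_square by (metis of_int_1 of_int_mult)
  have "jac z (- 1) = of_int sgn4 * jac z z"
    if z: "unit_root z" "z * z = - 1" "chi (- z) (- 1) = of_int sgn4" for z :: complex
  proof -
    have nz: "z \<noteq> 1" "z \<noteq> - 1" using z(2) by auto
    have mz: "unit_root (- z)" using unit_root_mult[OF z(1) unit_roots(3)] by simp
    have "conv (conv (chi z) (chi z)) (chi (- 1)) 0 = jac z z * (of_nat CARD('a) * unit0 (0::'a))"
    proof -
      have "conv (chi z) (chi z) = (\<lambda>c. jac z z * chi (- 1) c)"
        using conv_chi[OF z(1) z(1)] z(2) by auto
      then show ?thesis by (simp add: conv_scale_left conv_square)
    qed
    moreover have "conv (chi z) (conv (chi z) (chi (- 1))) 0 =
        jac z (- 1) * (of_int sgn4 * of_nat CARD('a) * unit0 (0::'a))"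
    proof -
      have "conv (chi z) (chi (- 1)) = (\<lambda>c. jac z (- 1) * chi (- z) c)"
        using conv_chi[OF z(1) unit_roots(3)] nz by (auto simp: equation_minus_iff[of _ 1] minus_equation_iff[of z])
      moreover have "conv (chi z) (chi (- z)) 0 = of_int sgn4 * of_nat CARD('a) * unit0 (0::'a)"
        using conv_chi_inverse[OF z(1) mz _ nz(1), of 0] z by simp
      ultimately show ?thesis by (simp add: conv_scale_right)
    qed
    ultimately have "jac z z = jac z (- 1) * of_int sgn4"
      using unit0_0 by (simp add: conv_assoc)
    then show ?thesis using sg by (simp add: mult_ac)
  qed
  from this[of \<i>] this[of "- \<i>"]
  show "jac \<i> (- 1) = of_int sgn4 * J" "jac (- \<i>) (- 1) = of_int sgn4 * J'"
    by (simp_all add: chi_minus_one)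
qed

lemma conv_quadratic: "conv (chi \<i>) (chi (- 1)) = (\<lambda>c. of_int sgn4 * J * chi (- \<i>) c)"
  "conv (chi (- \<i>)) (chi (- 1)) = (\<lambda>c. of_int sgn4 * J' * chi \<i> c)"
  by (auto simp: conv_chi jac_quadratic complex_eq_iff)

text \<open>Both bracketings of the convolution of \<chi>, \<chi> and the conjugate of \<chi> are
  evaluated at 1: one gives \<open>J * J'\<close>, the other \<open>q\<close>, each times
  \<open>sgn4\<close>.\<close>

lemma J_norm: "J * J' = of_nat CARD('a)"
proof -
  have sg: "of_int sgn4 \<noteq> (0 :: complex)" using sgn4_square by auto
  have "conv (conv (chi \<i>) (chi \<i>)) (chi (- \<i>)) 1 = of_int sgn4 * (J * J')"
    by (simp add: conv_square conv_scale_left conv_commute[of "chi (- 1)"] conv_quadratic)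
  moreover have "conv (chi \<i>) (conv (chi \<i>) (chi (- \<i>))) 1 = of_int sgn4 * of_nat CARD('a)"
    by (simp add: conv_square conv_scale_right conv_unit0 sum_chi)
  ultimately show ?thesis using sg by (simp add: conv_assoc)
qed

lemma jre_jim_norm: "jre\<^sup>2 + jim\<^sup>2 = int CARD('a)"
proof -
  have "of_int (jre\<^sup>2 + jim\<^sup>2) = (of_int (int CARD('a)) :: complex)"
    using J_norm unfolding J_eq by (simp add: algebra_simps power2_eq_square)
  then show ?thesis by (simp only: of_int_eq_iff)
qed

section \<open>The algebra spanned by \<open>unit0\<close> and the three characters\<close>

definition lin :: "complex \<Rightarrow> complex \<Rightarrow> complex \<Rightarrow> complex \<Rightarrow> 'a \<Rightarrow> complex" where
  "lin a b c d x = a * unit0 x + b * chi \<i> x + c * chi (- 1) x + d * chi (- \<i>) x"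

text \<open>This is the matrix of convolution by \<open>quart\<close> in the basis used by
  \<open>lin\<close>.\<close>

lemma conv_quart_lin:
  "conv quart (lin a b c d) =
    lin (of_nat CARD('a) * (of_int sgn4 * b + c + of_int sgn4 * d))
      (a + of_int sgn4 * J' * (c + d)) (a + J * b + J' * d) (a + of_int sgn4 * J * (b + c))"
proof
  fix x
  have sums: "(\<Sum>a\<in>UNIV. chi \<i> a) = 0" "(\<Sum>a\<in>UNIV. chi (- \<i>) a) = 0" "(\<Sum>a\<in>UNIV. chi (- 1) a) = (0::complex)"
    by (simp_all add: sum_chi complex_eq_iff)
  show "conv quart (lin a b c d) x = lin (of_nat CARD('a) * (of_int sgn4 * b + c + of_int sgn4 * d))
      (a + of_int sgn4 * J' * (c + d)) (a + J * b + J' * d) (a + of_int sgn4 * J * (b + c)) x"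
    unfolding lin_def [abs_def] quart_def [abs_def]
    by (simp only: conv_add_left conv_add_right conv_scale_right conv_unit0[OF sums(1)]
        conv_unit0[OF sums(2)] conv_unit0[OF sums(3)] conv_square conv_quadratic
        conv_commute[of "chi (- 1)" "chi \<i>"] conv_commute[of "chi (- 1)" "chi (- \<i>)"]
        conv_commute[of "chi (- \<i>)" "chi \<i>"]) (simp add: algebra_simps)
qed

text \<open>Each power applies this matrix to the previous one; \<open>J * J' = q\<close> and
  \<open>sgn4 * sgn4 = 1\<close> simplify the third.\<close>

lemma cpow_quart:
  "cpow quart 0 = lin 1 0 0 0"
  "cpow quart (Suc 0) = lin 0 1 1 1"
  "cpow quart (Suc (Suc 0)) = lin (of_nat CARD('a) * (2 * of_int sgn4 + 1)) (2 * of_int sgn4 * J') (J + J')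
     (2 * of_int sgn4 * J)"
  "cpow quart (Suc (Suc (Suc 0))) = lin (3 * of_nat CARD('a) * (J + J'))
     (of_nat CARD('a) * (2 * of_int sgn4 + 3) + of_int sgn4 * J' * (J + J'))
     (of_nat CARD('a) * (6 * of_int sgn4 + 1))
     (of_nat CARD('a) * (2 * of_int sgn4 + 3) + of_int sgn4 * J * (J + J'))"
proof -
  have sg: "of_int sgn4 * of_int sgn4 = (1 :: complex)"
    using sgn4_square by (metis of_int_1 of_int_mult)
  then have sg': "of_int sgn4 * (of_int sgn4 * x) = x" for x :: complex by (simp flip: mult.assoc)
  show 0: "cpow quart 0 = lin 1 0 0 0" by (auto simp: lin_def)
  then show 1: "cpow quart (Suc 0) = lin 0 1 1 1" by (simp only: cpow.simps(2) 0 conv_quart_lin) simp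
  then show 2: "cpow quart (Suc (Suc 0)) =
      lin (of_nat CARD('a) * (2 * of_int sgn4 + 1)) (2 * of_int sgn4 * J') (J + J') (2 * of_int sgn4 * J)"
    by (simp only: cpow.simps(2)[of _ "Suc _"] 1 conv_quart_lin) (simp add: algebra_simps)
  have JJ: "J * J' = of_nat CARD('a)" "J' * J = of_nat CARD('a)" using J_norm by (simp_all add: mult.commute)
  show "cpow quart (Suc (Suc (Suc 0))) = lin (3 * of_nat CARD('a) * (J + J'))
     (of_nat CARD('a) * (2 * of_int sgn4 + 3) + of_int sgn4 * J' * (J + J'))
     (of_nat CARD('a) * (6 * of_int sgn4 + 1))
     (of_nat CARD('a) * (2 * of_int sgn4 + 3) + of_int sgn4 * J * (J + J'))"
    by (simp only: cpow.simps(2)[of _ "Suc (Suc _)"] 2 conv_quart_lin)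
      (rule arg_cong4[where f = lin], simp_all add: algebra_simps sg' JJ)
qed

text \<open>The coefficients are those of the characteristic polynomial of the matrix in
  \<open>conv_quart_lin\<close>. Its trace is 0, hence no third power appears.\<close>

lemma cpow_quart_4:
  "cpow quart 4 x = (2 + 4 * of_int sgn4) * of_nat CARD('a) * cpow quart 2 x
     + 8 * of_nat CARD('a) * of_int jre * cpow quart 1 x
     + (4 * of_nat CARD('a) * of_int jre ^ 2 - (5 - 4 * of_int sgn4) * of_nat CARD('a) ^ 2) * cpow quart 0 x"
proof -
  have w: "of_int sgn4 = (1 :: complex) \<or> of_int sgn4 = (- 1 :: complex)"
    using sgn4_square by (auto simp: zmult_eq_1_iff)
  \<comment> \<open>With \<open>q\<close> and \<open>J'\<close> written through \<open>J\<close> and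
    \<open>jre\<close>, each sign of \<open>sgn4\<close> leaves a polynomial identity.\<close>
  have b: "J' = 2 * of_int jre - J" unfolding J_eq by simp
  have q: "of_nat CARD('a) = J * (2 * of_int jre - J)" using J_norm b by simp
  have 4: "cpow quart 4 = cpow quart (Suc (Suc (Suc (Suc 0))))" "cpow quart 2 = cpow quart (Suc (Suc 0))"
    "cpow quart 1 = cpow quart (Suc 0)" by (rule arg_cong, simp)+
  define r a where "r = (of_int jre :: complex)" and "a = J"
  have "cpow quart (Suc (Suc (Suc (Suc 0)))) x = (2 + 4 * of_int sgn4) * of_nat CARD('a) * cpow quart (Suc (Suc 0)) x
     + 8 * of_nat CARD('a) * of_int jre * cpow quart (Suc 0) x
     + (4 * of_nat CARD('a) * (of_int jre * of_int jre) - (5 - 4 * of_int sgn4) * (of_nat CARD('a) * of_nat CARD('a))) * cpow quart 0 x"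
    unfolding cpow.simps(2)[of _ "Suc (Suc (Suc 0))"] cpow_quart conv_quart_lin lin_def q
      b r_def[symmetric] a_def[symmetric]
    using w by (elim disjE; simp only:; simp add: algebra_simps)
  then show ?thesis by (simp only: 4 power2_eq_square)
qed

end

section \<open>The recurrence for the number of solutions\<close>

definition dev :: "'a::{field,finite} \<Rightarrow> nat \<Rightarrow> int" where
  "dev y n = int (M (n + 1) y) - int CARD('a) ^ n"

text \<open>The powers \<open>q ^ n\<close> make up the geometric fraction; as \<open>M_gf\<close>
  has no constant term, the deviation must vanish at 0.\<close>

lemma M_gf_eq_dev:
  fixes y :: "'a::{field,finite}"
  assumes "dev y 0 = 0"
  shows "M_gf y = of_nat CARD('a) * fps_X / (1 - of_nat CARD('a) * fps_X) + Abs_fps (\<lambda>n. of_int (dev y n))"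
proof -
  have "M_gf y = Abs_fps (\<lambda>n. if n \<ge> 1 then of_nat CARD('a) ^ n else 0) + Abs_fps (\<lambda>n. of_int (dev y n))"
    using assms by (intro fps_ext) (auto simp: M_gf_def dev_def Suc_le_eq)
  then show ?thesis unfolding fps_geometric fps_of_nat by simp
qed

lemma dev_eq_cpow:
  fixes T :: "'a::{field,finite} \<Rightarrow> complex"
  assumes "\<And>c. of_nat (roots4 c) = 1 + T c" and "(\<Sum>a\<in>UNIV. T a) = 0"
  shows "of_int (dev y n) = cpow T n 0 + (of_nat CARD('a) - 1) * cpow T n (- y)"
  using M_eq_cpow[OF assms, of n y] by (simp add: dev_def)

text \<open>The component along \<open>unit0\<close> contributes nothing to the deviation, so only
  the character coordinates of \<open>cpow\<close> matter.\<close>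

lemma unit0_weighted_sum:
  fixes y :: "'a::{field,finite}"
  assumes "y \<noteq> 0"
  shows "unit0 (0::'a) + (of_nat CARD('a) - 1) * unit0 (- y) = (0::complex)"
  using assms by (simp add: unit0_def field_simps)

context quartic_generator
begin

lemma cpow_quart_rec:
  "cpow quart (n + 4) x = (2 + 4 * of_int sgn4) * of_nat CARD('a) * cpow quart (n + 2) x
     + 8 * of_nat CARD('a) * of_int jre * cpow quart (n + 1) x
     + (4 * of_nat CARD('a) * of_int jre ^ 2 - (5 - 4 * of_int sgn4) * of_nat CARD('a) ^ 2) * cpow quart n x"
proof (induction n arbitrary: x)
  case 0
  show ?case using cpow_quart_4[of x] by (simp only: add_0_left)
next
  case (Suc n)
  have "cpow quart (Suc n + 4) x = conv quart (cpow quart (n + 4)) x"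
    by (simp only: add_Suc cpow.simps(2))
  also have "cpow quart (n + 4) = (\<lambda>x. (2 + 4 * of_int sgn4) * of_nat CARD('a) * cpow quart (n + 2) x
     + 8 * of_nat CARD('a) * of_int jre * cpow quart (n + 1) x
     + (4 * of_nat CARD('a) * of_int jre ^ 2 - (5 - 4 * of_int sgn4) * of_nat CARD('a) ^ 2) * cpow quart n x)"
    using Suc by (rule ext)
  finally show ?case
    by (simp only: conv_add_right conv_scale_right cpow.simps(2)[symmetric] add_Suc)
qed

lemma dev_quart: "of_int (dev y n) = cpow quart n 0 + (of_nat CARD('a) - 1) * cpow quart n (- y)"
  by (rule dev_eq_cpow[OF roots4_eq_quart sum_quart])

lemma dev_rec:
  "dev y (n + 4) = (2 + 4 * sgn4) * int CARD('a) * dev y (n + 2) + 8 * int CARD('a) * jre * dev y (n + 1)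
    + (4 * int CARD('a) * jre\<^sup>2 - (5 - 4 * sgn4) * (int CARD('a))\<^sup>2) * dev y n" for y :: 'a
proof -
  have "of_int (dev y (n + 4)) = (of_int ((2 + 4 * sgn4) * int CARD('a) * dev y (n + 2)
    + 8 * int CARD('a) * jre * dev y (n + 1)
    + (4 * int CARD('a) * jre\<^sup>2 - (5 - 4 * sgn4) * (int CARD('a))\<^sup>2) * dev y n) :: complex)"
    unfolding of_int_add of_int_mult of_int_diff dev_quart cpow_quart_rec
    by (simp add: algebra_simps)
  then show ?thesis by (simp only: of_int_eq_iff)
qed

text \<open>The conjugate coordinates of \<open>lin\<close> combine to twice a real part;
  \<open>jre * u + jim * v\<close> is the real part of \<open>J'\<close> times the quartic character
  at \<open>- y\<close>.\<close>

lemma dev_initial: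
  fixes y :: 'a
  assumes y: "y \<noteq> 0"
  defines "u \<equiv> re_chi (- y)" and "v \<equiv> im_chi (- y)"
  defines "r \<equiv> u\<^sup>2 - v\<^sup>2"
  shows "dev y 0 = 0"
    and "dev y 1 = (int CARD('a) - 1) * (2 * u + r)"
    and "dev y 2 = (int CARD('a) - 1) * (4 * sgn4 * (jre * u + jim * v) + 2 * jre * r)"
    and "dev y 3 = (int CARD('a) - 1) * (2 * int CARD('a) * (2 * sgn4 + 3) * u
        + 4 * jre * sgn4 * (jre * u + jim * v) + int CARD('a) * (6 * sgn4 + 1) * r)"
proof -
  have chi: "chi \<i> (- y) = of_int u + \<i> * of_int v" "chi (- \<i>) (- y) = of_int u - \<i> * of_int v"
    "chi (- 1) (- y) = (of_int r :: complex)"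
    using chi_eq_re_im[of \<i> "- y"] chi_eq_re_im[of "- \<i>" "- y"] chi_quadratic[of "- y"]
    by (simp_all add: u_def v_def r_def)
  have L: "lin a b c d 0 + (of_nat CARD('a) - 1) * lin a b c d (- y) =
      (of_nat CARD('a) - 1) * (b * (of_int u + \<i> * of_int v) + c * of_int r + d * (of_int u - \<i> * of_int v))"
    for a b c d
  proof -
    have "lin a b c d 0 + (of_nat CARD('a) - 1) * lin a b c d (- y) =
        a * (unit0 (0::'a) + (of_nat CARD('a) - 1) * unit0 (- y)) +
        (of_nat CARD('a) - 1) * (b * (of_int u + \<i> * of_int v) + c * of_int r + d * (of_int u - \<i> * of_int v))"
      unfolding lin_def chi by (simp add: algebra_simps)
    then show ?thesis unfolding unit0_weighted_sum[OF y] by simp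
  qed
  have "of_int (dev y 0) = (of_int 0 :: complex)"
    unfolding dev_quart cpow_quart L by simp
  then show "dev y 0 = 0" by (simp only: of_int_eq_iff)
  have "of_int (dev y 1) = (of_int ((int CARD('a) - 1) * (2 * u + r)) :: complex)"
    unfolding dev_quart cpow_quart One_nat_def L by simp
  then show "dev y 1 = (int CARD('a) - 1) * (2 * u + r)" by (simp only: of_int_eq_iff)
  have "of_int (dev y (Suc (Suc 0))) =
      (of_int ((int CARD('a) - 1) * (4 * sgn4 * (jre * u + jim * v) + 2 * jre * r)) :: complex)"
    unfolding dev_quart cpow_quart L J_eq by (simp add: algebra_simps)
  then show "dev y 2 = (int CARD('a) - 1) * (4 * sgn4 * (jre * u + jim * v) + 2 * jre * r)"
    by (simp only: of_int_eq_iff numeral_2_eq_2)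
  have "of_int (dev y (Suc (Suc (Suc 0)))) =
      (of_int ((int CARD('a) - 1) * (2 * int CARD('a) * (2 * sgn4 + 3) * u
        + 4 * jre * sgn4 * (jre * u + jim * v) + int CARD('a) * (6 * sgn4 + 1) * r)) :: complex)"
    unfolding dev_quart cpow_quart L J_eq by (simp add: algebra_simps)
  then show "dev y 3 = (int CARD('a) - 1) * (2 * int CARD('a) * (2 * sgn4 + 3) * u
        + 4 * jre * sgn4 * (jre * u + jim * v) + int CARD('a) * (6 * sgn4 + 1) * r)"
    by (simp only: of_int_eq_iff numeral_3_eq_3)
qed

lemma dev_gf:
  fixes y :: 'a
  assumes y: "y \<noteq> 0"
  defines "u \<equiv> re_chi (- y)" and "v \<equiv> im_chi (- y)"
  defines "r \<equiv> u\<^sup>2 - v\<^sup>2"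
  shows "Abs_fps (\<lambda>n. of_int (dev y n) :: rat) = (of_nat CARD('a) - 1) *
      (of_int (2 * u + r) * fps_X + of_int (4 * sgn4 * (jre * u + jim * v) + 2 * jre * r) * fps_X ^ 2
       + of_int (int CARD('a) * (2 * sgn4 - 1) * (r - 2 * u) + 4 * jre * sgn4 * (jre * u + jim * v)) * fps_X ^ 3)
     / (1 - of_int (2 + 4 * sgn4) * of_nat CARD('a) * fps_X ^ 2 - 8 * of_nat CARD('a) * of_int jre * fps_X ^ 3
       - (4 * of_nat CARD('a) * of_int jre ^ 2 - of_int (5 - 4 * sgn4) * of_nat CARD('a) ^ 2) * fps_X ^ 4)"
proof -
  let ?a = "\<lambda>n. of_int (dev y n) :: rat"
  define c2 where "c2 = (2 + 4 * sgn4) * int CARD('a)"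
  define c3 where "c3 = 8 * int CARD('a) * jre"
  define c4 where "c4 = 4 * int CARD('a) * jre\<^sup>2 - (5 - 4 * sgn4) * (int CARD('a))\<^sup>2"
  have rec: "?a (n + 4) = of_int c2 * ?a (n + 2) + of_int c3 * ?a (n + 1) + of_int c4 * ?a n" for n
    unfolding dev_rec c2_def c3_def c4_def by simp
  note init = dev_initial[OF y, folded u_def v_def, folded r_def]
  have 3: "?a 3 - of_int c2 * ?a 1 = of_int ((int CARD('a) - 1) *
      (int CARD('a) * (2 * sgn4 - 1) * (r - 2 * u) + 4 * jre * sgn4 * (jre * u + jim * v)))"
    unfolding init(2,4) c2_def by (simp only: of_int_mult[symmetric] of_int_diff[symmetric]) (simp add: algebra_simps)
  have gf: "Abs_fps ?a =
    (fps_const (?a 1) * fps_X + fps_const (?a 2) * fps_X ^ 2 + fps_const (?a 3 - of_int c2 * ?a 1) * fps_X ^ 3)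
    / (1 - fps_const (of_int c2) * fps_X ^ 2 - fps_const (of_int c3) * fps_X ^ 3 - fps_const (of_int c4) * fps_X ^ 4)"
    by (rule fps_recurrence4[OF _ rec]) (simp add: init(1))
  have const: "fps_const (of_int k :: rat) = of_int k" for k by (simp add: fps_of_int)
  show ?thesis
    unfolding gf unfolding 3 unfolding const init(2,3) c2_def c3_def c4_def
    by (intro arg_cong2[where f = "(/)"]) (simp_all add: algebra_simps)
qed

end

section \<open>Congruences for the Jacobi sum\<close>

lemma four_dvd_minus_one:
  fixes n :: nat
  assumes "[n = 1] (mod 4)"
  shows "4 dvd n - 1"
proof -
  have "n mod 4 = 1" using assms by (simp add: cong_def)
  then show ?thesis using dvd_minus_mod[of 4 n] by simp
qed

text \<open>Among the numbers from 1 to \<open>p * n + b\<close> the multiples of \<open>p\<close>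
  are \<open>p * i\<close> with \<open>1 \<le> i \<le> n\<close>: they give \<open>n\<close> factors
  \<open>p\<close> and then those of \<open>fact n\<close>.\<close>

lemma multiplicity_fact_mult_add:
  fixes p :: nat
  assumes p: "prime p" and b: "b < p"
  shows "multiplicity p (fact (p * n + b) :: nat) = n + multiplicity p (fact n :: nat)"
  using b
proof (induction n arbitrary: b)
  case 0
  then have "\<not> p dvd fact b" using p by (simp add: prime_dvd_fact_iff)
  then show ?case by (simp add: not_dvd_imp_multiplicity_0)
next
  case (Suc n)
  have pe: "prime_elem p" using p by (simp add: prime_imp_prime_elem)
  have base: "multiplicity p (fact (p * Suc n) :: nat) = Suc n + multiplicity p (fact (Suc n) :: nat)"
  proof -
    have p1: "p > 1" using p by (rule prime_gt_1_nat)
    \<comment> \<open>The top factor of the factorial is split off so that the induction hypothesis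
      applies with the largest remainder \<open>p - 1\<close>.\<close>
    then have "p * Suc n = Suc (p * n + (p - 1))" by simp
    then have "(fact (p * Suc n) :: nat) = (p * Suc n) * fact (p * n + (p - 1))"
      by (metis fact_Suc of_nat_id)
    then have "multiplicity p (fact (p * Suc n) :: nat) =
        multiplicity p p + multiplicity p (Suc n) + multiplicity p (fact (p * n + (p - 1)) :: nat)"
      using p1 by (simp add: prime_elem_multiplicity_mult_distrib[OF pe] del: mult_Suc_right)
    also have "\<dots> = 1 + multiplicity p (Suc n) + (n + multiplicity p (fact n :: nat))"
      using Suc.IH[of "p - 1"] p1 by (simp add: multiplicity_self)
    also have "\<dots> = Suc n + multiplicity p (fact (Suc n) :: nat)"
      by (simp add: prime_elem_multiplicity_mult_distrib[OF pe] del: mult_Suc)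
    finally show ?thesis .
  qed
  show ?case using Suc.prems
  proof (induction b)
    case 0
    then show ?case using base by simp
  next
    case (Suc b)
    have "\<not> p dvd Suc b" using Suc.prems by (simp add: nat_dvd_not_less)
    then have "\<not> p dvd p * Suc n + Suc b" by (metis dvd_add_right_iff dvd_triv_left)
    then have "\<not> p dvd Suc (p * Suc n + b)" by simp
    then have "multiplicity p (fact (Suc (p * Suc n + b)) :: nat) = multiplicity p (fact (p * Suc n + b) :: nat)"
      unfolding fact_Suc
      by (simp add: prime_elem_multiplicity_mult_distrib[OF pe] not_dvd_imp_multiplicity_0
          del: mult_Suc mult_Suc_right)
    then show ?case using Suc by (simp del: fact_Suc)
  qed
qed

text \<open>In base \<open>p\<close> all digits of \<open>(p ^ m - 1) div 4\<close> equal \<open>(p - 1) div 4\<close>, so adding it to its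
  double produces no carry.\<close>

lemma not_dvd_binomial_quarter:
  fixes p :: nat
  assumes p: "prime p" and p4: "[p = 1] (mod 4)"
  defines "k \<equiv> \<lambda>m. (p ^ m - 1) div 4"
  shows "\<not> p dvd (3 * k m choose k m)"
proof -
  have pe: "prime_elem p" using p by (simp add: prime_imp_prime_elem)
  define e where "e = (p - 1) div 4"
  have p1: "p > 1" using p by (rule prime_gt_1_nat)
  have e: "p = 4 * e + 1"
  proof -
    have "4 dvd p - 1" using p4 by (rule four_dvd_minus_one)
    then show ?thesis using p1 by (simp add: e_def)
  qed
  have k4: "p ^ m = 4 * k m + 1" for m
  proof -
    have "[p ^ m = 1] (mod 4)" using cong_pow[OF p4, of m] by simp
    then have "4 dvd p ^ m - 1" by (rule four_dvd_minus_one)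
    then show ?thesis using p1 by (simp add: k_def)
  qed
  \<comment> \<open>Passing to \<open>Suc m\<close> appends the digit \<open>e\<close> in base
    \<open>p\<close>.\<close>
  have k: "k (Suc m) = p * k m + e" for m
  proof -
    have "4 * k (Suc m) + 1 = p * (4 * k m + 1)" using k4[of "Suc m"] k4[of m] by simp
    then show ?thesis using e by simp
  qed
  have "multiplicity p (fact (3 * k m) :: nat) =
      multiplicity p (fact (k m) :: nat) + multiplicity p (fact (2 * k m) :: nat)"
  proof (induction m)
    case 0
    then show ?case by (simp add: k_def)
  next
    case (Suc m)
    have "multiplicity p (fact (j * k (Suc m)) :: nat) = j * k m + multiplicity p (fact (j * k m) :: nat)"
      if "j < 4" for j
    proof -
      \<comment> \<open>No carry: \<open>j * e\<close> remains a single digit since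
        \<open>3 * e < p\<close>.\<close>
      have "j * e \<le> 3 * e" using that by (intro mult_right_mono) auto
      then have "j * e < p" using e by linarith
      from multiplicity_fact_mult_add[OF p this, of "j * k m"] show ?thesis
        by (simp add: k algebra_simps)
    qed
    from this[of 1] this[of 2] this[of 3] Suc show ?case by simp
  qed
  moreover have "fact (k m) * fact (2 * k m) * (3 * k m choose k m) = (fact (3 * k m) :: nat)"
    using binomial_fact_lemma[of "k m" "3 * k m"] by simp
  then have "multiplicity p (fact (3 * k m) :: nat) = multiplicity p (fact (k m) :: nat)
      + multiplicity p (fact (2 * k m) :: nat) + multiplicity p (3 * k m choose k m)"
    by (metis (no_types, lifting) binomial_eq_0_iff fact_nonzero mult_eq_0_iff
        prime_elem_multiplicity_mult_distrib[OF pe])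
  ultimately have "multiplicity p (3 * k m choose k m) = 0" by simp
  moreover have "(3 * k m choose k m) \<noteq> 0" by simp
  ultimately show ?thesis using p1 multiplicity_eq_zero_iff[of "3 * k m choose k m" p] by simp
qed

text \<open>Binomial expansion reduces the sum to power sums, of which only those with exponent
  divisible by \<open>q - 1\<close> survive.\<close>

lemma (in field_generator) sum_power_mult_one_minus_power:
  assumes "i > 0"
  shows "(\<Sum>a\<in>UNIV. a ^ i * (1 - a) ^ n) =
    (\<Sum>j\<le>n. if (CARD('a) - 1) dvd (i + j) then - of_nat (n choose j) * (- 1) ^ j else (0 :: 'a))"
proof -
  have "a ^ i * (1 - a) ^ n = (\<Sum>j\<le>n. of_nat (n choose j) * (- 1) ^ j * a ^ (i + j))" for a :: 'a
  proof -
    have "(1 - a) ^ n = (\<Sum>j\<le>n. of_nat (n choose j) * (- a) ^ j * 1 ^ (n - j))"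
      using binomial_ring[of "- a" 1 n] by simp
    then show ?thesis
      by (simp add: sum_distrib_left power_minus[of a] power_add mult_ac)
  qed
  then have "(\<Sum>a\<in>UNIV. a ^ i * (1 - a) ^ n) =
      (\<Sum>j\<le>n. of_nat (n choose j) * (- 1) ^ j * (\<Sum>a\<in>UNIV. a ^ (i + j) :: 'a))"
    by (simp add: sum_distrib_left) (rule sum.swap)
  also have "\<dots> = (\<Sum>j\<le>n. if (CARD('a) - 1) dvd (i + j) then - of_nat (n choose j) * (- 1) ^ j else 0)"
    using assms by (intro sum.cong refl) (simp add: sum_power del: One_nat_def)
  finally show ?thesis .
qed

section \<open>Reduction of the Jacobi sum to the finite field\<close>

context quartic_generator
begin

definition quarter :: nat where
  "quarter = (CARD('a) - 1) div 4"

lemma card_quarter: "CARD('a) - 1 = 4 * quarter" "quarter > 0"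
  using four_dvd card_ge_2 by (auto simp: quarter_def)

definition iota :: 'a where
  "iota = g ^ quarter"

lemma iota_square: "iota * iota = - 1"
  using gen_quarter by (simp add: iota_def quarter_def)

lemma iota_cube: "- iota = g ^ (3 * quarter)"
proof -
  have "g ^ (3 * quarter) = iota * iota * iota"
    by (simp add: iota_def eval_nat_numeral add.assoc flip: power_add)
  then show ?thesis by (simp add: iota_square)
qed

text \<open>The exponents lie between \<open>quarter\<close> and \<open>2 * quarter\<close>, so none
  is a multiple of \<open>4 * quarter\<close>.\<close>

lemma jac_iota: "of_int jre + iota * of_int jim = 0"
proof -
  have "of_int jre + iota * of_int jim = jac iota iota" by (rule jac_eq[OF iota_square, symmetric])
  also have "\<dots> = (\<Sum>a\<in>UNIV. a ^ quarter * (1 - a) ^ quarter)"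
    by (simp add: jac_def iota_def chi_gen_power_eq_power card_quarter)
  also have "\<dots> = (\<Sum>j\<le>quarter. 0)"
    unfolding sum_power_mult_one_minus_power[OF card_quarter(2)] card_quarter(1)
    by (intro sum.cong refl) (use card_quarter(2) in \<open>auto dest!: dvd_imp_le\<close>)
  finally show ?thesis by simp
qed

text \<open>The exponents now run from \<open>3 * quarter\<close> to \<open>6 * quarter\<close>, and
  \<open>4 * quarter\<close> is the only multiple of itself among them.\<close>

lemma jac_minus_iota:
  "of_int jre - iota * of_int jim = - of_nat (3 * quarter choose quarter) * (- 1) ^ quarter"
proof -
  have dvd_iff: "4 * quarter dvd 3 * quarter + j \<longleftrightarrow> j = quarter" if "j \<le> 3 * quarter" for j
  proof
    assume "4 * quarter dvd 3 * quarter + j"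
    then obtain c where c: "3 * quarter + j = 4 * quarter * c" by (auto simp: dvd_def)
    have "c \<noteq> 0" using c card_quarter(2) by (cases c) auto
    moreover have "c < 2"
    proof (rule ccontr)
      assume "\<not> c < 2"
      then have "4 * quarter * 2 \<le> 4 * quarter * c" by (intro mult_left_mono) auto
      then show False using c that card_quarter(2) by linarith
    qed
    ultimately have "c = 1" by simp
    then show "j = quarter" using c by simp
  qed simp
  have "of_int jre - iota * of_int jim = jac (- iota) (- iota)"
    using jac_eq[of "- iota"] iota_square by simp
  also have "\<dots> = (\<Sum>a\<in>UNIV. a ^ (3 * quarter) * (1 - a) ^ (3 * quarter))"
    unfolding iota_cube by (simp add: jac_def chi_gen_power_eq_power card_quarter)
  also have "\<dots> = (\<Sum>j\<le>3 * quarter. if j = quarter then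
      - of_nat (3 * quarter choose quarter) * (- 1) ^ quarter else 0)"
    using card_quarter(2)
    by (subst sum_power_mult_one_minus_power, simp, unfold card_quarter(1), intro sum.cong refl)
      (simp add: dvd_iff)
  finally show ?thesis by simp
qed

section \<open>The residue of the Jacobi sum modulo 4\<close>

definition quad_chi :: "'a \<Rightarrow> int" where
  "quad_chi c = (re_chi c)\<^sup>2 - (im_chi c)\<^sup>2"

lemma re_im_quad_one: "re_chi 1 = 1" "im_chi 1 = 0" "quad_chi 1 = 1"
proof -
  have "of_int (re_chi 1) + \<i> * of_int (im_chi 1) = 1"
    using chi_eq_re_im[of \<i> 1] by simp
  then show "re_chi 1 = 1" "im_chi 1 = 0" by (simp_all add: complex_eq_iff)
  then show "quad_chi 1 = 1" by (simp add: quad_chi_def)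
qed

lemma sum_re_chi_quad_chi: "(\<Sum>a\<in>UNIV. re_chi a * quad_chi (1 - a)) = sgn4 * jre"
proof -
  have "jac \<i> (- 1) = of_int (\<Sum>a\<in>UNIV. re_chi a * quad_chi (1 - a))
      + \<i> * of_int (\<Sum>a\<in>UNIV. im_chi a * quad_chi (1 - a))"
    by (simp add: jac_def chi_eq_re_im[of \<i>] chi_quadratic quad_chi_def algebra_simps sum.distrib sum_subtractf
        sum_distrib_left)
  then have "of_int sgn4 * (of_int jre + \<i> * of_int jim) = of_int (\<Sum>a\<in>UNIV. re_chi a * quad_chi (1 - a))
      + \<i> * of_int (\<Sum>a\<in>UNIV. im_chi a * quad_chi (1 - a))"
    unfolding jac_quadratic J_eq .
  then have "of_int (sgn4 * jre) = (of_int (\<Sum>a\<in>UNIV. re_chi a * quad_chi (1 - a)) :: real)"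
    by (auto simp: complex_eq_iff)
  then show ?thesis by (simp only: of_int_eq_iff)
qed

lemma sum_quad_chi_quad_chi: "(\<Sum>a\<in>UNIV. quad_chi a * quad_chi (1 - a)) = - 1"
proof -
  have "of_int (\<Sum>a\<in>UNIV. quad_chi a * quad_chi (1 - a)) = conv (chi (- 1)) (chi (- 1)) 1"
    by (simp add: conv_def chi_quadratic quad_chi_def)
  also have "\<dots> = of_int (- 1)" by (simp add: conv_square unit0_def)
  finally show ?thesis by (simp only: of_int_eq_iff)
qed

lemma sum_re_quad: "(\<Sum>a\<in>UNIV. re_chi a) = 0" "(\<Sum>a\<in>UNIV. quad_chi a) = 0"
proof -
  have "of_int (\<Sum>a\<in>UNIV. re_chi a) + \<i> * of_int (\<Sum>a\<in>UNIV. im_chi a) = (\<Sum>a\<in>UNIV. chi \<i> a)"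
    by (simp add: chi_eq_re_im[of \<i>] sum.distrib sum_distrib_left)
  also have "\<dots> = 0" by (rule sum_chi) (simp_all add: complex_eq_iff)
  finally have "(of_int (\<Sum>a\<in>UNIV. re_chi a) :: real) = of_int 0" by (simp add: complex_eq_iff)
  then show "(\<Sum>a\<in>UNIV. re_chi a) = 0" by (simp only: of_int_eq_iff)
  have "of_int (\<Sum>a\<in>UNIV. quad_chi a) = (\<Sum>a\<in>UNIV. chi (- 1) a :: complex)"
    by (simp add: chi_quadratic quad_chi_def)
  also have "\<dots> = of_int 0" by (simp add: sum_chi)
  finally show "(\<Sum>a\<in>UNIV. quad_chi a) = 0" by (simp only: of_int_eq_iff)
qed

lemma jre_mod_4: "[jre = 3] (mod 4)"
proof -
  \<comment> \<open>The second product corrects the first so that every term is a multiple of 8,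
    while the total is still computable from character and Jacobi sums: it is
    \<open>2 * (sgn4 * jre) + q + 1\<close>.\<close>
  let ?F = "\<lambda>a b. 2 * ((re_chi a - 1) * (quad_chi b - 1)) - (1 - quad_chi a) * (1 - quad_chi b)"
  have dvd: "8 dvd ?F a (1 - a)" for a
  proof -
    have "8 dvd ?F a b" if "a \<noteq> 0" "b \<noteq> 0" for b
      using mod_4_cases[of "ind g a"] mod_4_cases[of "ind g b"] that by (auto simp: re_chi_def im_chi_def quad_chi_def)
    then show ?thesis
      by (cases "a = 0 \<or> 1 - a = 0") (auto simp: re_im_quad_one)
  qed
  have "8 dvd (\<Sum>a\<in>UNIV. ?F a (1 - a))" by (rule dvd_sum) (rule dvd)
  also have "(\<Sum>a\<in>UNIV. ?F a (1 - a)) =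
      2 * ((\<Sum>a\<in>UNIV. re_chi a * quad_chi (1 - a)) - (\<Sum>a\<in>UNIV. re_chi a) - (\<Sum>a\<in>UNIV. quad_chi (1 - a)) + int CARD('a))
      - (int CARD('a) - (\<Sum>a\<in>UNIV. quad_chi a) - (\<Sum>a\<in>UNIV. quad_chi (1 - a))
         + (\<Sum>a\<in>UNIV. quad_chi a * quad_chi (1 - a)))"
    by (simp add: algebra_simps sum.distrib sum_subtractf sum_distrib_left)
  also have "\<dots> = 2 * (sgn4 * jre) + int CARD('a) + 1"
    by (simp add: sum_re_chi_quad_chi sum_quad_chi_quad_chi sum_re_quad sum_UNIV_diff)
  finally have "8 dvd 2 * (sgn4 * jre) + int CARD('a) + 1" .
  moreover have "int CARD('a) = 4 * int quarter + 1" using card_quarter by linarith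
  ultimately have d: "8 dvd 2 * (sgn4 * jre) + 4 * int quarter + 2" by (simp add: add_ac)
  show ?thesis
  proof (cases "even quarter")
    case True
    then have "sgn4 = 1" by (simp add: sgn4_def quarter_def[symmetric] del: One_nat_def)
    then show ?thesis using d True unfolding cong_def by presburger
  next
    case False
    then have "sgn4 = - 1" by (simp add: sgn4_def quarter_def[symmetric] del: One_nat_def)
    then show ?thesis using d False unfolding cong_def by presburger
  qed
qed

end

section \<open>Identification of the pair \<open>(s, t)\<close>\<close>

lemma CHAR_eq_if_CARD_prime_power:
  assumes "prime p" and "CARD('a::{field,finite}) = p ^ m"
  shows "CHAR('a) = p"
proof -
  have "CHAR('a) > 0" by (rule finite_imp_CHAR_pos) simp
  then have "prime CHAR('a)" by (rule prime_CHAR_semidom)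
  moreover have "CHAR('a) dvd p ^ m" using CHAR_dvd_CARD[where 'a = 'a] assms(2) by simp
  ultimately show ?thesis using assms(1) by (metis prime_dvd_power primes_dvd_imp_eq)
qed

text \<open>If \<open>p\<close> does not divide \<open>s s' - 4 t t'\<close>, then \<open>p ^ m\<close> divides its cofactor
  \<open>s s' + 4 t t'\<close> in \<open>(s s')\<^sup>2 - (4 t t')\<^sup>2\<close>, and the identity
  \<open>(s s' + 4 t t')\<^sup>2 + 4 (s' t - s t')\<^sup>2 = p ^ (2 m)\<close> leaves only \<open>s' t = s t'\<close>.\<close>

lemma sum_squares_unique:
  fixes p :: nat and s t s' t' :: int
  assumes p: "prime p" "odd p"
    and st: "int (p ^ m) = s\<^sup>2 + 4 * t\<^sup>2" "[s = 1] (mod 4)"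
    and st': "int (p ^ m) = s'\<^sup>2 + 4 * t'\<^sup>2" "[s' = 1] (mod 4)"
    and ndvd: "\<not> int p dvd s * s' - 4 * t * t'"
  shows "s = s' \<and> t = t'"
proof -
  define q where "q = int (p ^ m)"
  have q: "q = s\<^sup>2 + 4 * t\<^sup>2" "q = s'\<^sup>2 + 4 * t'\<^sup>2" using st st' by (simp_all add: q_def)
  have qpos: "q > 0" using p by (simp add: q_def prime_gt_0_nat)
  have qodd: "odd q" using p by (simp add: q_def)
  let ?A = "s * s' + 4 * t * t'" and ?B = "s' * t - s * t'"
  have "(s * s' - 4 * t * t') * ?A = s\<^sup>2 * s'\<^sup>2 - (4 * t\<^sup>2) * (4 * t'\<^sup>2)" by (simp add: algebra_simps power2_eq_square)
  also have "\<dots> = s\<^sup>2 * s'\<^sup>2 - (q - s\<^sup>2) * (q - s'\<^sup>2)" using q by simp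
  also have "\<dots> = q * (s\<^sup>2 + s'\<^sup>2 - q)" by (simp add: algebra_simps power2_eq_square)
  finally have "q dvd (s * s' - 4 * t * t') * ?A" by simp
  moreover have "coprime q (s * s' - 4 * t * t')"
  proof -
    have "prime (int p)" using p by simp
    then have "coprime (int p) (s * s' - 4 * t * t')" using ndvd by (rule prime_imp_coprime)
    then show ?thesis by (simp add: q_def)
  qed
  ultimately have dvd: "q dvd ?A" by (simp add: coprime_dvd_mult_right_iff)
  have norm: "?A\<^sup>2 + 4 * ?B\<^sup>2 = q\<^sup>2"
  proof -
    have "?A\<^sup>2 + 4 * ?B\<^sup>2 = (s\<^sup>2 + 4 * t\<^sup>2) * (s'\<^sup>2 + 4 * t'\<^sup>2)" by (simp add: algebra_simps power2_eq_square)
    then show ?thesis using q by (simp add: power2_eq_square)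
  qed
  obtain c where c: "?A = q * c" using dvd by (auto simp: dvd_def)
  have "?A \<noteq> 0"
  proof
    assume "?A = 0"
    then have "even (q\<^sup>2)" using norm by (metis add_0 dvd_mult2 even_numeral zero_power2)
    then show False using qodd by simp
  qed
  then have "c \<noteq> 0" using c by auto
  have "q\<^sup>2 * c\<^sup>2 \<le> q\<^sup>2 * 1" using norm unfolding c by (simp add: power_mult_distrib) (smt (verit) zero_le_power2)
  then have "c\<^sup>2 \<le> 1" using qpos by simp
  then have "\<bar>c\<bar> \<le> 1" by (simp add: abs_square_le_1)
  then have c1: "c = 1 \<or> c = - 1" using \<open>c \<noteq> 0\<close> by linarith
  then have "?A\<^sup>2 = q\<^sup>2" unfolding c by auto
  then have B: "s' * t = s * t'" using norm by simp
  have "s * q = s' * ?A"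
  proof -
    have "s * q = s * s'\<^sup>2 + 4 * t' * (s * t')" unfolding q(2) by (simp add: algebra_simps power2_eq_square)
    also have "\<dots> = s' * ?A" unfolding B[symmetric] by (simp add: algebra_simps power2_eq_square)
    finally show ?thesis .
  qed
  then have "q * s = q * (c * s')" unfolding c by (simp add: algebra_simps)
  then have sc: "s = c * s'" using qpos by simp
  \<comment> \<open>Both \<open>s\<close> and \<open>s'\<close> are 1 modulo 4, which rules out
    opposite signs.\<close>
  have "c \<noteq> - 1"
  proof
    assume "c = - 1"
    then have "s = - s'" using sc by simp
    then show False using st(2) st'(2) unfolding cong_def by presburger
  qed
  then have "s = s'" using c1 sc by auto
  moreover have "s' \<noteq> 0" using st'(2) by (auto simp: cong_def)
  ultimately show ?thesis using B by simp
qed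

text \<open>If \<open>p\<close> does not divide \<open>a\<close>, raising \<open>a\<^sup>2\<close>
  and \<open>- b\<^sup>2\<close> to the odd power \<open>(p - 1) div 2\<close> makes 1 congruent to
  \<open>- 1\<close>, by Fermat.\<close>

lemma dvd_if_dvd_sum_squares:
  fixes p :: nat and a b :: int
  assumes p: "prime p" "[p = 3] (mod 4)" and dvd: "int p dvd a\<^sup>2 + b\<^sup>2"
  shows "int p dvd a"
proof (rule ccontr)
  assume na: "\<not> int p dvd a"
  have pi: "prime (int p)" using p by simp
  have nb: "\<not> int p dvd b"
  proof
    assume "int p dvd b"
    then have "int p dvd b\<^sup>2" by (simp add: power2_eq_square)
    then have "int p dvd a\<^sup>2" using dvd by (simp add: dvd_add_left_iff)
    then show False using na pi by (simp add: prime_dvd_power_iff)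
  qed
  have fermat: "[c ^ (p - 1) = 1] (mod int p)" if c: "\<not> int p dvd c" for c :: int
  proof -
    have "\<not> p dvd nat \<bar>c\<bar>" using c by (metis int_dvd_int_iff dvd_abs_iff int_nat_eq abs_ge_zero)
    then have "[nat \<bar>c\<bar> ^ (p - 1) = 1] (mod p)" using p(1) by (intro fermat_theorem)
    then have "[int (nat \<bar>c\<bar> ^ (p - 1)) = int 1] (mod int p)" by (simp only: cong_int_iff)
    moreover have "int (nat \<bar>c\<bar> ^ (p - 1)) = \<bar>c\<bar> ^ (p - 1)" by simp
    moreover have "even (p - 1)"
    proof -
      have "odd p" using p(2) unfolding cong_def by presburger
      then show ?thesis by simp
    qed
    then have "\<bar>c\<bar> ^ (p - 1) = c ^ (p - 1)" by (rule power_even_abs)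
    ultimately show ?thesis by simp
  qed
  obtain k where k: "p = 4 * k + 3"
    using p(2) by (metis cong_def mod_mod_trivial mult_div_mod_eq mod_less numeral_less_iff semiring_norm(81,79,78,75,80,76))
  have "p - 1 = 2 * (2 * k + 1)" using k by simp
  then have e: "c ^ (p - 1) = (c\<^sup>2) ^ (2 * k + 1)" for c :: int by (simp only: power_mult)
  have "[a\<^sup>2 = - (b\<^sup>2)] (mod int p)" using dvd by (simp add: cong_iff_dvd_diff)
  then have "[(a\<^sup>2) ^ (2 * k + 1) = (- (b\<^sup>2)) ^ (2 * k + 1)] (mod int p)" by (rule cong_pow)
  then have "[a ^ (p - 1) = - (b ^ (p - 1))] (mod int p)" unfolding e by simp
  moreover have "[- (b ^ (p - 1)) = - 1] (mod int p)" using fermat[OF nb] by (simp add: cong_minus_minus_iff)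
  ultimately have "[1 = - 1] (mod int p)" using fermat[OF na] by (meson cong_sym cong_trans)
  then have "int p dvd 2" by (simp add: cong_iff_dvd_diff)
  then show False using k zdvd_imp_le[of "int p" 2] by simp
qed

text \<open>Descent on \<open>r\<close>: \<open>p\<close> divides both numbers and can be cancelled,
  until two squares with sum 1 remain.\<close>

lemma sum_squares_inert:
  fixes p :: nat and a b :: int
  assumes p: "prime p" "[p = 3] (mod 4)" and "a\<^sup>2 + b\<^sup>2 = int p ^ (2 * r)"
  shows "a = 0 \<or> b = 0"
  using assms(3)
proof (induction r arbitrary: a b)
  case 0
  show ?case
  proof (rule ccontr)
    assume "\<not> (a = 0 \<or> b = 0)"
    then have "a\<^sup>2 > 0" "b\<^sup>2 > 0" by simp_all
    moreover have "a\<^sup>2 + b\<^sup>2 = 1" using 0 by simp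
    ultimately show False by linarith
  qed
next
  case (Suc r)
  have p0: "int p \<noteq> 0" using p by auto
  have "int p dvd a\<^sup>2 + b\<^sup>2" "int p dvd b\<^sup>2 + a\<^sup>2"
    unfolding add.commute[of "b\<^sup>2"] Suc.prems by simp_all
  then have "int p dvd a" "int p dvd b" by (auto intro: dvd_if_dvd_sum_squares[OF p])
  then obtain a' b' where ab: "a = int p * a'" "b = int p * b'" by (auto simp: dvd_def)
  have "(int p)\<^sup>2 * (a'\<^sup>2 + b'\<^sup>2) = (int p)\<^sup>2 * int p ^ (2 * r)"
    using Suc.prems unfolding ab by (simp add: power_mult_distrib algebra_simps power2_eq_square)
  then have "a'\<^sup>2 + b'\<^sup>2 = int p ^ (2 * r)" using p0 by simp
  then show ?case using Suc.IH ab by auto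
qed

context quartic_generator
begin

lemma jim_even: "jim = 2 * (jim div 2)"
proof -
  have "odd (jre\<^sup>2 + jim\<^sup>2)" unfolding jre_jim_norm using odd_card by simp
  moreover have "odd jre" using jre_mod_4 unfolding cong_def by presburger
  ultimately have "even jim" by simp
  then show ?thesis by simp
qed

text \<open>For \<open>p\<close> congruent to 1 modulo 4 the pair from the Jacobi sum is shown to
  qualify, and any two qualifying pairs to agree; for 3 the norm determines the Jacobi sum up to
  sign and its residue modulo 4 fixes the sign.\<close>

lemma quartic_pair_iff:
  assumes p: "prime p" "odd p" and card: "CARD('a) = p ^ m"
  shows "quartic_pair p m g s t \<longleftrightarrow> s = - jre \<and> t = jim div 2"
proof (cases "[p = 1] (mod 4)")
  case True
  have char: "CHAR('a) = p" by (rule CHAR_eq_if_CARD_prime_power[OF p(1) card])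
  have zero_iff: "(of_int z :: 'a) = 0 \<longleftrightarrow> int p dvd z" for z
    by (simp add: of_int_eq_0_iff_char_dvd char)
  have pi: "prime (int p)" using p by simp
  have e: "g ^ (3 * (p ^ m - 1) div 4) = - iota"
    unfolding iota_cube quarter_def card[symmetric] using four_dvd by (auto simp del: One_nat_def)
  \<comment> \<open>Otherwise both reductions of the Jacobi sum would vanish, and with them a
    binomial coefficient prime to \<open>p\<close>.\<close>
  have "(of_int jre :: 'a) \<noteq> 0"
  proof
    assume "(of_int jre :: 'a) = 0"
    then have "iota * of_int jim = 0" using jac_iota by simp
    then have "of_nat (3 * quarter choose quarter) = (0 :: 'a)"
      using jac_minus_iota unfolding \<open>of_int jre = 0\<close> \<open>iota * of_int jim = 0\<close> by simp
    then show False
      using not_dvd_binomial_quarter[OF p(1) True, of m]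
      by (simp add: of_nat_eq_0_iff_char_dvd char quarter_def card)
  qed
  then have ndvd: "\<not> int p dvd jre" by (simp add: zero_iff)
  have ex: "quartic_pair p m g (- jre) (jim div 2)"
  proof -
    obtain h where h: "jim = 2 * h" using jim_even by blast
    have "int (p ^ m) = (- jre)\<^sup>2 + 4 * (jim div 2)\<^sup>2"
      using jre_jim_norm unfolding card[symmetric] h by (simp add: power_mult_distrib)
    moreover have "gcd (int p) (- jre) = 1"
      using prime_imp_coprime[OF pi ndvd] by (simp add: coprime_iff_gcd_eq_1)
    moreover have "[- jre = 1] (mod 4)" using jre_mod_4 unfolding cong_def by presburger
    moreover have "of_int (2 * (jim div 2)) = of_int (- jre) * (- iota)"
    proof -
      have "iota * (of_int jre + iota * of_int jim) = 0" using jac_iota by simp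
      then have "iota * of_int jre + (iota * iota) * of_int jim = 0" by (simp add: algebra_simps)
      then show ?thesis unfolding iota_square h by (simp add: algebra_simps)
    qed
    ultimately show ?thesis using True unfolding quartic_pair_def e by simp
  qed
  have "s = s' \<and> t = t'" if "quartic_pair p m g s t" "quartic_pair p m g s' t'" for s t s' t'
  proof (rule sum_squares_unique[OF p])
    show "int (p ^ m) = s\<^sup>2 + 4 * t\<^sup>2" "[s = 1] (mod 4)" "int (p ^ m) = s'\<^sup>2 + 4 * t'\<^sup>2" "[s' = 1] (mod 4)"
      using that True by (simp_all add: quartic_pair_def)
    have t: "of_int (2 * t) = of_int s * (- iota)" "of_int (2 * t') = of_int s' * (- iota)"
      and g: "gcd (int p) s = 1" "gcd (int p) s' = 1"
      using that True unfolding quartic_pair_def e by simp_all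
    \<comment> \<open>The field condition gives \<open>(2 * t) * (2 * t') = - (s * s')\<close>, so
      the difference equals \<open>2 * (s * s')\<close> in the field, where no factor
      vanishes.\<close>
    show "\<not> int p dvd s * s' - 4 * t * t'"
    proof
      assume "int p dvd s * s' - 4 * t * t'"
      then have "int p dvd s * s' - (2 * t) * (2 * t')" by (simp add: mult.assoc)
      then have "(of_int (s * s' - (2 * t) * (2 * t')) :: 'a) = 0" by (simp only: zero_iff)
      then have "of_int s * of_int s' - of_int (2 * t) * of_int (2 * t') = (0 :: 'a)"
        by (simp only: of_int_diff of_int_mult)
      then have "of_int s * of_int s' - (iota * iota) * (of_int s * of_int s') = (0 :: 'a)"
        unfolding t by (simp add: algebra_simps)
      then have "(of_int (2 * (s * s')) :: 'a) = 0" unfolding iota_square by auto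
      then have "int p dvd 2 * (s * s')" by (simp only: zero_iff)
      moreover have "\<not> int p dvd 2"
      proof
        assume "int p dvd 2"
        then have "p \<le> 2" using zdvd_imp_le[of "int p" 2] by simp
        then show False using p prime_ge_2_nat[OF p(1)] by simp
      qed
      ultimately have "int p dvd s \<or> int p dvd s'" using pi by (simp add: prime_dvd_mult_iff)
      then show False using g prime_gt_1_nat[OF p(1)] by (auto simp: gcd_proj1_iff gcd_proj1_if_dvd_int)
    qed
  qed
  with ex show ?thesis by blast
next
  case False
  have p3: "[p = 3] (mod 4)"
    using p(1)
  proof (cases rule: prime_cong_4_nat_cases)
    case 2
    then show ?thesis using p(2) by simp
  qed (use False in simp_all)
  have q1: "[p ^ m = 1] (mod 4)"
  proof -
    have "p ^ m = 4 * quarter + 1" using card_quarter card_ge_2 card by linarith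
    then show ?thesis by (simp add: cong_def)
  qed
  have p': "[- int p = 1] (mod 4)"
  proof -
    have "int p mod 4 = 3" using p3 unfolding cong_def by presburger
    then show ?thesis unfolding cong_def by presburger
  qed
  \<comment> \<open>For odd \<open>m\<close> the power \<open>p ^ m\<close> would be 3 modulo
    4.\<close>
  have even: "even m"
  proof (rule ccontr)
    assume "odd m"
    have "[(- int p) ^ m = 1] (mod 4)" using cong_pow[OF p', of m] by simp
    then have "[- int (p ^ m) = 1] (mod 4)" using \<open>odd m\<close> by simp
    moreover have "[int (p ^ m) = int 1] (mod int 4)" using q1 by (simp only: cong_int_iff)
    moreover have "[- x = 1] (mod 4) \<Longrightarrow> [x = 1] (mod 4) \<Longrightarrow> False" for x :: int
      unfolding cong_def by presburger
    ultimately show False by simp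
  qed
  define r where "r = m div 2"
  have m: "m = 2 * r" using even by (simp add: r_def)
  have norm: "jre\<^sup>2 + jim\<^sup>2 = int p ^ (2 * r)" unfolding jre_jim_norm card m by simp
  have "jre \<noteq> 0" using jre_mod_4 by (auto simp: cong_def)
  then have jim: "jim = 0" using sum_squares_inert[OF p(1) p3 norm] by simp
  then have "jre\<^sup>2 = ((- int p) ^ r)\<^sup>2" using norm by (simp add: power_mult[symmetric] mult.commute)
  then have "jre = (- int p) ^ r \<or> jre = - ((- int p) ^ r)" by (simp add: power2_eq_iff)
  moreover have "[(- int p) ^ r = 1] (mod 4)" using cong_pow[OF p', of r] by simp
  then have "jre \<noteq> (- int p) ^ r" using jre_mod_4 by (auto simp: cong_def)
  ultimately have "(- int p) ^ r = - jre" by simp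
  then show ?thesis using False jim by (auto simp: quartic_pair_def r_def)
qed

end

section \<open>The generating functions\<close>

context quartic_generator
begin

text \<open>One formula for the four cases, in the coordinates of the character at \<open>c\<close>;
  \<open>2 * t * v - s * u\<close> is \<open>jre * u + jim * v\<close> once \<open>jre = - s\<close>
  and \<open>jim = 2 * t\<close>.\<close>

lemma B1_eq:
  fixes c :: 'a
  assumes "c \<noteq> 0" and q: "int CARD('a) = s\<^sup>2 + 4 * t\<^sup>2"
  defines "u \<equiv> re_chi c" and "v \<equiv> im_chi c"
  defines "r \<equiv> u\<^sup>2 - v\<^sup>2"
  shows "3 * fps_X ^ 2 + B1 s t g c = of_int (2 * u + r) * fps_X
    + of_int (4 * (2 * t * v - s * u) - 2 * s * r) * fps_X ^ 2
    + of_int (int CARD('a) * (r - 2 * u) - 4 * s * (2 * t * v - s * u)) * fps_X ^ 3"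
  unfolding r_def u_def v_def B1_def Let_def q
  using mod_4_cases[of "ind g c"]
  by (elim disjE)
    (simp_all add: assms(1) re_chi_def im_chi_def cong_def algebra_simps power2_eq_square)

text \<open>The analogue of \<open>B1_eq\<close> for \<open>sgn4 = - 1\<close>.\<close>

lemma B2_eq:
  fixes c :: 'a
  assumes "c \<noteq> 0" and q: "int CARD('a) = s\<^sup>2 + 4 * t\<^sup>2"
  defines "u \<equiv> re_chi c" and "v \<equiv> im_chi c"
  defines "r \<equiv> u\<^sup>2 - v\<^sup>2"
  shows "- (fps_X ^ 2) + B2 s t g c = of_int (2 * u + r) * fps_X
    + of_int (- 4 * (2 * t * v - s * u) - 2 * s * r) * fps_X ^ 2
    + of_int (- 3 * int CARD('a) * (r - 2 * u) + 4 * s * (2 * t * v - s * u)) * fps_X ^ 3"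
  unfolding r_def u_def v_def B2_def Let_def q
  using mod_4_cases[of "ind g c"]
  by (elim disjE)
    (simp_all add: assms(1) re_chi_def im_chi_def cong_def algebra_simps power2_eq_square)

text \<open>The index of \<open>- 1\<close> is \<open>2 * quarter\<close>, a multiple of 4, so
  \<open>B1\<close> may be taken at \<open>y\<close> although the deviation involves
  \<open>- y\<close>.\<close>

lemma ind_minus_mod_4:
  assumes "even quarter" and "c \<noteq> 0"
  shows "ind g (- c) mod 4 = ind g c mod 4"
proof -
  have h: "(CARD('a) - 1) div 2 = 2 * quarter" using card_quarter(1) by simp
  have "g ^ ind g (- c) = g ^ (2 * quarter + ind g c)"
    using assms(2) minus_one_eq[OF odd_card] unfolding h by (simp add: ind_props power_add)
  then have "[ind g (- c) = 2 * quarter + ind g c] (mod CARD('a) - 1)" unfolding gen_power_eq_iff .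
  then have "[ind g (- c) = 2 * quarter + ind g c] (mod 4)"
    by (rule cong_dvd_modulus_nat) (rule four_dvd)
  moreover obtain k where "quarter = 2 * k" using assms(1) by blast
  ultimately show ?thesis by (simp add: cong_def mult.assoc[symmetric])
qed

lemma M_gf_1_mod_8:
  fixes y :: 'a
  assumes "y \<noteq> 0" and "even quarter"
    and s: "jre = - s" and t: "jim = 2 * t"
  shows "M_gf y = of_nat CARD('a) * fps_X / (1 - of_nat CARD('a) * fps_X)
    + (of_nat CARD('a) - 1) * (3 * fps_X ^ 2 + B1 s t g y)
      / (1 - 6 * of_nat CARD('a) * fps_X ^ 2 + 8 * of_nat CARD('a) * of_int s * fps_X ^ 3
         + (of_nat CARD('a) ^ 2 - 4 * of_nat CARD('a) * of_int s ^ 2) * fps_X ^ 4)"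
proof -
  have sg: "sgn4 = 1" using assms(2) by (simp add: sgn4_def quarter_def[symmetric] del: One_nat_def)
  have q: "int CARD('a) = s\<^sup>2 + 4 * t\<^sup>2"
    using jre_jim_norm unfolding s t by (simp add: power_mult_distrib)
  have e: "re_chi (- y) = re_chi y" "im_chi (- y) = im_chi y"
    using ind_minus_mod_4[OF assms(2,1)] by (simp_all add: re_chi_def im_chi_def)
  show ?thesis
    unfolding M_gf_eq_dev[OF dev_initial(1)[OF assms(1)]] dev_gf[OF assms(1)] sg s t e
      B1_eq[OF assms(1) q]
    by (intro arg_cong2[where f = "(+)"] arg_cong2[where f = "(/)"] refl)
      (simp_all add: algebra_simps)
qed

lemma M_gf_5_mod_8:
  fixes y :: 'a
  assumes "y \<noteq> 0" and "odd quarter"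
    and s: "jre = - s" and t: "jim = 2 * t"
  shows "M_gf y = of_nat CARD('a) * fps_X / (1 - of_nat CARD('a) * fps_X)
    + (of_nat CARD('a) - 1) * (- (fps_X ^ 2) + B2 s t g (- y))
      / (1 + 2 * of_nat CARD('a) * fps_X ^ 2 + 8 * of_nat CARD('a) * of_int s * fps_X ^ 3
         + (9 * of_nat CARD('a) ^ 2 - 4 * of_nat CARD('a) * of_int s ^ 2) * fps_X ^ 4)"
proof -
  have sg: "sgn4 = - 1" using assms(2) by (simp add: sgn4_def quarter_def[symmetric] del: One_nat_def)
  have q: "int CARD('a) = s\<^sup>2 + 4 * t\<^sup>2"
    using jre_jim_norm unfolding s t by (simp add: power_mult_distrib)
  have y: "- y \<noteq> 0" using assms(1) by simp
  show ?thesis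
    unfolding M_gf_eq_dev[OF dev_initial(1)[OF assms(1)]] dev_gf[OF assms(1)] sg s t
      B2_eq[OF y q]
    by (intro arg_cong2[where f = "(+)"] arg_cong2[where f = "(/)"] refl)
      (simp_all add: algebra_simps)
qed

end

text \<open>The quadratic character convolved with itself is \<open>- q * unit0\<close>, so the
  deviation satisfies a recurrence of order two.\<close>

lemma (in field_generator) M_gf_3_mod_4:
  fixes y :: 'a
  assumes card: "[CARD('a) = 3] (mod 4)" and y: "y \<noteq> 0" "\<forall>z. y \<noteq> z ^ 4"
  shows "M_gf y = of_nat CARD('a) * fps_X / (1 - of_nat CARD('a) * fps_X)
    + (of_nat CARD('a) - 1) * fps_X / (1 + of_nat CARD('a) * fps_X ^ 2)"
proof -
  let ?T = "chi (- 1) :: 'a \<Rightarrow> complex" and ?q = "of_nat CARD('a) :: complex"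
  have "CARD('a) mod 4 = 3" using card by (simp add: cong_def)
  then obtain k where k: "CARD('a) = 4 * k + 3" by (metis mult_div_mod_eq)
  have odd: "odd CARD('a)" using k by simp
  have root: "unit_root (- 1 :: complex)" using odd by (simp add: unit_root_def)
  have "(CARD('a) - 1) div 2 = 2 * k + 1" using k by simp
  then have m1: "?T (- 1) = - 1"
    using chi_gen_power[OF root, of "(CARD('a) - 1) div 2"] unfolding minus_one_eq[OF odd] by simp
  have sum: "(\<Sum>a\<in>UNIV. ?T a) = 0" by (rule sum_chi[OF root]) simp
  have TT: "conv ?T ?T = (\<lambda>c. - ?q * unit0 c)"
    using conv_chi_inverse[OF root root] m1 by auto
  have cpow1: "cpow ?T (Suc 0) = ?T" by (simp add: conv_unit0[OF sum])
  have rec: "cpow ?T (n + 2) c = - ?q * cpow ?T n c" for n c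
  proof (induction n arbitrary: c)
    case 0
    show ?case by (simp add: conv_unit0[OF sum] TT numeral_2_eq_2)
  next
    case (Suc n)
    have "cpow ?T (n + 2) = (\<lambda>c. - ?q * cpow ?T n c)" using Suc by (rule ext)
    then show ?case by (simp only: add_Suc cpow.simps(2) conv_scale_right)
  qed
  note dev = dev_eq_cpow[OF roots4_if_3_mod_4[OF card] sum, of y]
  have dev_rec: "dev y (n + 2) = - int CARD('a) * dev y n" for n
  proof -
    have "of_int (dev y (n + 2)) = (of_int (- int CARD('a) * dev y n) :: complex)"
      unfolding of_int_mult dev rec by (simp add: algebra_simps)
    then show ?thesis by (simp only: of_int_eq_iff)
  qed
  have dev0: "dev y 0 = 0"
  proof -
    have "of_int (dev y 0) = (of_int 0 :: complex)"
      unfolding dev using unit0_weighted_sum[OF y(1)] by simp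
    then show ?thesis by (simp only: of_int_eq_iff)
  qed
  have dev1: "dev y 1 = int CARD('a) - 1"
  proof -
    \<comment> \<open>As \<open>y\<close> is not a fourth power, its character value is
      \<open>- 1\<close>; that of \<open>- y\<close> is then 1.\<close>
    have "roots4 y = 0" using y(2) by (auto simp: roots4_def)
    then have "1 + ?T y = 0" using roots4_if_3_mod_4[OF card, of y] by simp
    then have "?T y = - 1" by (simp add: eq_neg_iff_add_eq_0 add.commute)
    then have "?T (- y) = 1" using chi_mult[OF root, of "- 1" y] m1 by simp
    then have "of_int (dev y 1) = (of_int (int CARD('a) - 1) :: complex)"
      unfolding dev One_nat_def cpow1 by simp
    then show ?thesis by (simp only: of_int_eq_iff)
  qed
  have dev2: "dev y 2 = 0" using dev_rec[of 0] dev0 by (simp add: numeral_2_eq_2)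
  have dev3: "dev y 3 = - int CARD('a) * dev y 1"
    using dev_rec[of 1] by (simp add: numeral_3_eq_3 numeral_2_eq_2)
  \<comment> \<open>The order-two recurrence is recast as one of order four with vanishing lower
    coefficients, to reuse \<open>fps_recurrence4\<close>.\<close>
  have rec4: "of_int (dev y (n + 4)) = of_int (- int CARD('a)) * of_int (dev y (n + 2))
      + 0 * of_int (dev y (n + 1)) + 0 * (of_int (dev y n) :: rat)" for n
  proof -
    have "dev y (n + 4) = - int CARD('a) * dev y (n + 2)"
      using dev_rec[of "n + 2"] unfolding add.assoc by (simp only: numeral_plus_numeral add_num_simps)
    then show ?thesis by simp
  qed
  have "Abs_fps (\<lambda>n. of_int (dev y n) :: rat) =
      (of_nat CARD('a) - 1) * fps_X / (1 + of_nat CARD('a) * fps_X ^ 2)"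
    using fps_recurrence4[OF _ rec4]
    by (simp add: dev0 dev1[unfolded One_nat_def] dev2 dev3 fps_of_nat flip: fps_const_neg fps_const_sub)
  then show ?thesis using M_gf_eq_dev[OF dev0] by simp
qed

theorem theorem1p2:
  fixes p m q :: nat and g y :: "'a::{field,finite}"
  assumes "prime p" and "odd p" and "m \<ge> 1" and "q = p ^ m" and "CARD('a) = q"
    and "generates_units g"
    and "y \<noteq> 0" and "\<forall>z. y \<noteq> z ^ 4"
  shows "([q = 1] (mod 4) \<longrightarrow>
      (\<exists>!(s, t). quartic_pair p m g s t) \<and>
      (\<forall>s t. quartic_pair p m g s t \<longrightarrow>
        ([q = 1] (mod 8) \<longrightarrow>
          M_gf y = of_nat q * fps_X / (1 - of_nat q * fps_X)
            + (of_nat q - 1) * (3 * fps_X ^ 2 + B1 s t g y)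
              / (1 - 6 * of_nat q * fps_X ^ 2 + 8 * of_nat q * of_int s * fps_X ^ 3
                 + (of_nat q ^ 2 - 4 * of_nat q * of_int s ^ 2) * fps_X ^ 4)) \<and>
        ([q = 5] (mod 8) \<longrightarrow>
          M_gf y = of_nat q * fps_X / (1 - of_nat q * fps_X)
            + (of_nat q - 1) * (- (fps_X ^ 2) + B2 s t g (- y))
              / (1 + 2 * of_nat q * fps_X ^ 2 + 8 * of_nat q * of_int s * fps_X ^ 3
                 + (9 * of_nat q ^ 2 - 4 * of_nat q * of_int s ^ 2) * fps_X ^ 4))))
    \<and> ([q = 3] (mod 4) \<longrightarrow>
        M_gf y = of_nat q * fps_X / (1 - of_nat q * fps_X)
          + (of_nat q - 1) * fps_X / (1 + of_nat q * fps_X ^ 2))"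
proof (intro conjI impI allI)
  interpret field_generator g by unfold_locales (rule assms(6))
  have card: "CARD('a) = p ^ m" using assms(4,5) by simp
  {
    assume "[q = 1] (mod 4)"
    then have "4 dvd CARD('a) - 1" unfolding assms(5) by (rule four_dvd_minus_one)
    then interpret quartic_generator g by unfold_locales
    note iff = quartic_pair_iff[OF assms(1,2) card]
    show "\<exists>!(s, t). quartic_pair p m g s t" unfolding iff by auto
    have q: "q = 4 * quarter + 1" using card_quarter card_ge_2 unfolding assms(5) by linarith
    fix s t
    assume "quartic_pair p m g s t"
    then have st: "jre = - s" "jim = 2 * t" using jim_even unfolding iff by auto
    {
      assume "[q = 1] (mod 8)"
      then have "even quarter" unfolding q cong_def by presburger
      from M_gf_1_mod_8[OF assms(7) this st]
      show "M_gf y = of_nat q * fps_X / (1 - of_nat q * fps_X)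
            + (of_nat q - 1) * (3 * fps_X ^ 2 + B1 s t g y)
              / (1 - 6 * of_nat q * fps_X ^ 2 + 8 * of_nat q * of_int s * fps_X ^ 3
                 + (of_nat q ^ 2 - 4 * of_nat q * of_int s ^ 2) * fps_X ^ 4)"
        unfolding assms(5) .
    next
      assume "[q = 5] (mod 8)"
      then have "odd quarter" unfolding q cong_def by presburger
      from M_gf_5_mod_8[OF assms(7) this st]
      show "M_gf y = of_nat q * fps_X / (1 - of_nat q * fps_X)
            + (of_nat q - 1) * (- (fps_X ^ 2) + B2 s t g (- y))
              / (1 + 2 * of_nat q * fps_X ^ 2 + 8 * of_nat q * of_int s * fps_X ^ 3
                 + (9 * of_nat q ^ 2 - 4 * of_nat q * of_int s ^ 2) * fps_X ^ 4)"
        unfolding assms(5) .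
    }
  next
    assume "[q = 3] (mod 4)"
    then show "M_gf y = of_nat q * fps_X / (1 - of_nat q * fps_X)
          + (of_nat q - 1) * fps_X / (1 + of_nat q * fps_X ^ 2)"
      using M_gf_3_mod_4[OF _ assms(7,8)] unfolding assms(5) by blast
  }
qed

end
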